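(* Let $\mathbf A=(\theta,w,x)$ be a simple Q-system in $\mathcal C\subset\mathrm{End}_0(N)$, describing a subfactor $\iota:N\to M$ with conjugate $\bar\iota:M\to N$. Let one of the following be given: (a) a projection $p\in\mathrm{Hom}(\theta,\theta)$ with $(1_\theta\times p)x=xp$ and $pw=(w^*p\times1_\theta)xw$; (b) a projection $\bar p\in\mathrm{Hom}(\theta,\theta)$ with $(\bar p\times1_\theta)x=x\bar p$ and $\bar pw=(1_\theta\times w^*\bar p)xw$; or (c) a projection $P\in\mathrm{Hom}(\theta,\theta)$ with $(w^*P\times1_\theta\times w^*P)x^{(2)}=P$, where $x^{(2)}=(x\times 1_\theta)x$. Each of these defines the other two via $\bar p=(w^*p\times1_\theta)x$, $p=(1_\theta\times w^*\bar p)x$, $P=\bar pp$, respectively $\bar p=(w^*P\times1_\theta)x$, $p=(1_\theta\times w^*P)x$. Assume $P\neq 0$ and let $S\in N$ be an isometry with $SS^*=P$. Then $$n_P:=S^*x^*(P\times P)xS=\sqrt{\dim(\theta_P)}\cdot1_{\theta_P},$$ and $$\theta_P=S^*\theta(\cdot)S,\qquad w_P=S^*w,\qquad x_P=(S^*\times S^* )\,x\,S$$ defines a Q-system $\mathbf A_P=(\theta_P,w_P,x_P)$. It is the Q-system associated with a homomorphism $\iota_p\prec\iota$, namely the range of the projection $e\in\mathrm{Hom}(\iota,\iota)$ with $\bar\iota(e)=p$, such that $\iota$ is a direct sum $[\iota]=[\iota_p]\oplus[\iota_{1-p}]$ (where $\iota_{1-p}$ is the range of $1-e$).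
   Context: $N$ is an infinite (type III) von Neumann factor on a separable Hilbert space. For homomorphisms (unital $*$-homomorphisms) $\alpha,\beta:N\to M$, $\mathrm{Hom}(\alpha,\beta)=\{t\in M:t\alpha(n)=\beta(n)t\ \forall n\}$. For $t_i\in\mathrm{Hom}(\alpha_i,\beta_i)$ put $t_1\times t_2=t_1\alpha_1(t_2)\in\mathrm{Hom}(\alpha_1\alpha_2,\beta_1\beta_2)$; thus $1_\alpha\times t=\alpha(t)$, $t\times1_\alpha=t$. $\alpha:N\to M$, $\bar\alpha:M\to N$ are conjugate if there are $w\in\mathrm{Hom}(\mathrm{id}_N,\bar\alpha\alpha)$, $\bar w\in\mathrm{Hom}(\mathrm{id}_M,\alpha\bar\alpha)$ with $w^*\bar\alpha(\bar w)=1$, $\alpha(w^* )\bar w=1$; $\dim\alpha$ is the infimum of $d$ over such pairs with $w^*w=d1_N$, $\bar w^*\bar w=d1_M$; pairs attaining it are standard. $\mathrm{End}_0(N)$ is the C* tensor category of endomorphisms of finite dimension; $\mathcal C\subset\mathrm{End}_0(N)$ is a full tensor subcategory closed under direct sums, subobjects and conjugates. For a homomorphism $\alpha:N\to M$ of infinite factors and a projection $e\in\mathrm{Hom}(\alpha,\alpha)$, the range of $e$ is $\alpha_s=s^*\alpha(\cdot)s$ with $s\in M$ an isometry, $ss^*=e$ (well defined up to unitary equivalence); one writes $\alpha_s\prec\alpha$. $[\alpha]=[\alpha_1]\oplus[\alpha_2]$ means $\alpha=s_1\alpha_1(\cdot)s_1^*+s_2\alpha_2(\cdot)s_2^*$ with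 isometries $s_i^*s_j=\delta_{ij}$, $\sum_is_is_i^*=1$. A Q-system is a triple $(\theta,w,x)$ with $\theta\in\mathcal C$, $w\in\mathrm{Hom}(\mathrm{id},\theta)$, $x\in\mathrm{Hom}(\theta,\theta^2)$ satisfying $(w^*\times1_\theta)x=(1_\theta\times w^* )x=1_\theta$; $(x\times1_\theta)x=(1_\theta\times x)x$; $(1_\theta\times x^* )(x\times1_\theta)=xx^*=(x^*\times1_\theta)(1_\theta\times x)$; $w^*w=d1$, $x^*x=d1_\theta$ with $d=\sqrt{\dim\theta}$. Its extension $\iota:N\to M$ is the von Neumann algebra $M=\iota(N)v$ (each element uniquely $\iota(n)v$) with $v\iota(n)=\iota(\theta(n))v$, $v^2=\iota(x)v$, $v^*=\iota(w^*x^* )v$, $1_M=\iota(w^* )v$, and conjugate $\bar\iota(\iota(n)v)=\theta(n)x$. The Q-system is simple if $M$ is a factor. The Q-system associated with a homomorphism $\varphi:N\to M$ of factors of finite dimension is $(\bar\varphi\varphi,w_\varphi,\bar\varphi(v_\varphi))$ for a conjugate $\bar\varphi$ and a standard pair $(w_\varphi,v_\varphi)$, well defined up to unitary equivalence of Q-systems. *)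

theory Defs
  imports "HOL-Analysis.Analysis"
begin

section \<open>Complex Hilbert spaces and bounded operators\<close>

class scaleC =
  fixes scaleC :: "complex \<Rightarrow> 'a \<Rightarrow> 'a"  (infixr "*\<^sub>C" 75)

text \<open>The inner product is linear in the second argument.  Positivity and definiteness of the
  inner product follow from the norm axioms via \<open>norm_cinner\<close> (recall that \<open>sqrt\<close> of a
  negative real is negative).\<close>

class chilbert_space = banach + scaleC +
  fixes cinner :: "'a \<Rightarrow> 'a \<Rightarrow> complex"
  assumes scaleR_scaleC: "r *\<^sub>R x = complex_of_real r *\<^sub>C x"
    and scaleC_add_right: "a *\<^sub>C (x + y) = a *\<^sub>C x + a *\<^sub>C y"
    and scaleC_add_left: "(a + b) *\<^sub>C x = a *\<^sub>C x + b *\<^sub>C x"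
    and scaleC_scaleC: "a *\<^sub>C b *\<^sub>C x = (a * b) *\<^sub>C x"
    and cinner_commute: "cinner x y = cnj (cinner y x)"
    and cinner_add_right: "cinner x (y + z) = cinner x y + cinner x z"
    and cinner_scaleC_right: "cinner x (a *\<^sub>C y) = a * cinner x y"
    and norm_cinner: "norm x = sqrt (Re (cinner x x))"
begin

lemma scaleC_zero_right: "a *\<^sub>C 0 = 0"
  using scaleC_add_right[of a 0 0] by simp

lemma scaleC_minus_right: "a *\<^sub>C (- x) = - (a *\<^sub>C x)"
proof -
  have "a *\<^sub>C (- x) + a *\<^sub>C x = 0"
    using scaleC_add_right[of a "- x" x] by (simp add: scaleC_zero_right)
  then show ?thesis
    by (simp add: eq_neg_iff_add_eq_0)
qed

lemma norm_scaleC: "norm (a *\<^sub>C x) = cmod a * norm x"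
proof -
  have 1: "cinner (a *\<^sub>C x) x = cnj a * cinner x x"
    using cinner_commute[of "a *\<^sub>C x" x] cinner_commute[of x x]
    by (simp add: cinner_scaleC_right)
  have "cinner (a *\<^sub>C x) (a *\<^sub>C x) = (a * cnj a) * cinner x x"
    by (simp add: cinner_scaleC_right 1)
  also have "\<dots> = complex_of_real ((cmod a)\<^sup>2) * cinner x x"
    using complex_norm_square[of a] by simp
  finally have "Re (cinner (a *\<^sub>C x) (a *\<^sub>C x)) = (cmod a)\<^sup>2 * Re (cinner x x)"
    by simp
  then show ?thesis
    by (simp add: norm_cinner real_sqrt_mult)
qed

end

typedef (overloaded) 'a bop =
  "{f :: 'a::chilbert_space \<Rightarrow> 'a. bounded_linear f \<and> (\<forall>c x. f (c *\<^sub>C x) = c *\<^sub>C f x)}"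
  morphisms apply_bop Abs_bop
  by (rule exI[of _ "\<lambda>x. x"]) (simp add: bounded_linear_ident)

setup_lifting type_definition_bop

text \<open>Addition is pointwise and multiplication is composition.  The class \<open>ring_1\<close> is not
  available because \<open>0 = 1\<close> on the zero Hilbert space.\<close>

instantiation bop :: (chilbert_space) "{ring, monoid_mult}"
begin

lift_definition zero_bop :: "'a bop" is "\<lambda>x. 0"
  by (simp add: scaleC_zero_right)

lift_definition one_bop :: "'a bop" is "\<lambda>x. x"
  by (simp add: bounded_linear_ident)

lift_definition plus_bop :: "'a bop \<Rightarrow> 'a bop \<Rightarrow> 'a bop" is "\<lambda>f g x. f x + g x"
  by (simp add: bounded_linear_add scaleC_add_right)

lift_definition uminus_bop :: "'a bop \<Rightarrow> 'a bop" is "\<lambda>f x. - f x"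
  by (simp add: bounded_linear_minus scaleC_minus_right)

lift_definition minus_bop :: "'a bop \<Rightarrow> 'a bop \<Rightarrow> 'a bop" is "\<lambda>f g x. f x - g x"
proof -
  fix f g :: "'a \<Rightarrow> 'a"
  assume "bounded_linear f \<and> (\<forall>c x. f (c *\<^sub>C x) = c *\<^sub>C f x)"
    and "bounded_linear g \<and> (\<forall>c x. g (c *\<^sub>C x) = c *\<^sub>C g x)"
  moreover have "c *\<^sub>C (x - y) = c *\<^sub>C x - c *\<^sub>C y" for c and x y :: 'a
    using scaleC_add_right[of c x "- y"] by (simp add: scaleC_minus_right)
  ultimately show "bounded_linear (\<lambda>x. f x - g x) \<and>
      (\<forall>c x. f (c *\<^sub>C x) - g (c *\<^sub>C x) = c *\<^sub>C (f x - g x))"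
    by (simp add: bounded_linear_sub)
qed

lift_definition times_bop :: "'a bop \<Rightarrow> 'a bop \<Rightarrow> 'a bop" is "\<lambda>f g x. f (g x)"
  by (simp add: bounded_linear_compose)

instance
proof
  fix a b c :: "'a bop"
  show "a + b + c = a + (b + c)" by transfer (simp add: add.assoc)
  show "a + b = b + a" by transfer (simp add: add.commute)
  show "0 + a = a" by transfer simp
  show "- a + a = 0" by transfer simp
  show "a - b = a + - b" by transfer simp
  show "a * b * c = a * (b * c)" by transfer simp
  show "1 * a = a" by transfer simp
  show "a * 1 = a" by transfer simp
  show "(a + b) * c = a * c + b * c" by transfer simp
  show "a * (b + c) = a * b + a * c"
    by transfer (simp add: linear_simps(1))
qed

end

instantiation bop :: (chilbert_space) scaleC
begin

lift_definition scaleC_bop :: "complex \<Rightarrow> 'a bop \<Rightarrow> 'a bop" is "\<lambda>c f x. c *\<^sub>C f x"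
proof -
  fix c and f :: "'a \<Rightarrow> 'a"
  assume f: "bounded_linear f \<and> (\<forall>c x. f (c *\<^sub>C x) = c *\<^sub>C f x)"
  have "bounded_linear (\<lambda>x::'a. c *\<^sub>C x)"
    by (rule bounded_linear_intro[of _ "cmod c"])
      (simp_all add: scaleC_add_right scaleR_scaleC scaleC_scaleC norm_scaleC mult.commute)
  from bounded_linear_compose[OF this, of f] f
  show "bounded_linear (\<lambda>x. c *\<^sub>C f x) \<and> (\<forall>d x. c *\<^sub>C f (d *\<^sub>C x) = d *\<^sub>C c *\<^sub>C f x)"
    by (simp add: scaleC_scaleC mult.commute)
qed

instance ..

end

text \<open>Existence of the adjoint is the Riesz representation theorem.\<close>

definition adj :: "'h::chilbert_space bop \<Rightarrow> 'h bop" where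
  "adj A = (THE B. \<forall>x y. cinner (apply_bop A x) y = cinner x (apply_bop B y))"

definition is_proj :: "'h::chilbert_space bop \<Rightarrow> bool" where
  "is_proj p \<longleftrightarrow> p * p = p \<and> adj p = p"

definition is_isometry :: "'h::chilbert_space bop \<Rightarrow> bool" where
  "is_isometry s \<longleftrightarrow> adj s * s = 1"

definition is_unitary :: "'h::chilbert_space bop \<Rightarrow> bool" where
  "is_unitary u \<longleftrightarrow> adj u * u = 1 \<and> u * adj u = 1"


section \<open>Von Neumann algebras and type III factors\<close>

definition commutant :: "'h::chilbert_space bop set \<Rightarrow> 'h bop set" where
  "commutant N = {t. \<forall>n\<in>N. t * n = n * t}"

definition von_neumann_algebra :: "'h::chilbert_space bop set \<Rightarrow> bool" where
  "von_neumann_algebra N \<longleftrightarrow> adj ` N \<subseteq> N \<and> commutant (commutant N) = N"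

text \<open>The clause \<open>1 \<noteq> 0\<close> excludes the algebra of operators on the zero Hilbert space.\<close>

definition factor :: "'h::chilbert_space bop set \<Rightarrow> bool" where
  "factor N \<longleftrightarrow> von_neumann_algebra N \<and> (1::'h bop) \<noteq> 0 \<and>
     N \<inter> commutant N = range (\<lambda>c. c *\<^sub>C 1)"

text \<open>A projection is infinite relative to \<open>N\<close> if it is Murray--von Neumann equivalent in \<open>N\<close>
  to a proper subprojection of itself; \<open>e * (u * adj u) = u * adj u\<close> says that the range
  projection of \<open>u\<close> lies below \<open>e\<close>.\<close>

definition infinite_proj :: "'h::chilbert_space bop set \<Rightarrow> 'h bop \<Rightarrow> bool" where
  "infinite_proj N e \<longleftrightarrow> e \<in> N \<and> is_proj e \<and>
     (\<exists>u\<in>N. adj u * u = e \<and> e * (u * adj u) = u * adj u \<and> u * adj u \<noteq> e)"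

definition type_III_factor :: "'h::chilbert_space bop set \<Rightarrow> bool" where
  "type_III_factor N \<longleftrightarrow> factor N \<and>
     (\<forall>e\<in>N. is_proj e \<and> e \<noteq> 0 \<longrightarrow> infinite_proj N e)"


section \<open>Homomorphisms, intertwiners, conjugates and dimension\<close>

text \<open>A homomorphism \<open>N \<rightarrow> M\<close> is represented by a function on all operators; its values outside
  the set \<open>N\<close> are irrelevant, and equality of homomorphisms is equality on \<open>N\<close>.\<close>

definition star_hom :: "'h::chilbert_space bop set \<Rightarrow> 'k::chilbert_space bop set \<Rightarrow>
    ('h bop \<Rightarrow> 'k bop) \<Rightarrow> bool" where
  "star_hom N M \<alpha> \<longleftrightarrow> \<alpha> ` N \<subseteq> M \<and> \<alpha> 1 = 1 \<and>
     (\<forall>a\<in>N. \<forall>b\<in>N. \<alpha> (a + b) = \<alpha> a + \<alpha> b \<and> \<alpha> (a * b) = \<alpha> a * \<alpha> b) \<and>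
     (\<forall>c. \<forall>a\<in>N. \<alpha> (c *\<^sub>C a) = c *\<^sub>C \<alpha> a) \<and>
     (\<forall>a\<in>N. \<alpha> (adj a) = adj (\<alpha> a))"

definition Hom :: "'h::chilbert_space bop set \<Rightarrow> 'k::chilbert_space bop set \<Rightarrow>
    ('h bop \<Rightarrow> 'k bop) \<Rightarrow> ('h bop \<Rightarrow> 'k bop) \<Rightarrow> 'k bop set" where
  "Hom N M \<alpha> \<beta> = {t \<in> M. \<forall>n\<in>N. t * \<alpha> n = \<beta> n * t}"

text \<open>The monoidal product \<open>t\<^sub>1 \<times> t\<^sub>2\<close> depends on the source \<open>\<alpha>\<^sub>1\<close> of \<open>t\<^sub>1\<close>, which is therefore an
  explicit argument. The identity arrow of every endomorphism is \<open>1\<close>.\<close>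

definition hprod :: "('h::chilbert_space bop \<Rightarrow> 'k::chilbert_space bop) \<Rightarrow>
    'k bop \<Rightarrow> 'h bop \<Rightarrow> 'k bop" where
  "hprod \<alpha>1 t1 t2 = t1 * \<alpha>1 t2"

definition conjugate_pair :: "'h::chilbert_space bop set \<Rightarrow> 'k::chilbert_space bop set \<Rightarrow>
    ('h bop \<Rightarrow> 'k bop) \<Rightarrow> ('k bop \<Rightarrow> 'h bop) \<Rightarrow> 'h bop \<Rightarrow> 'k bop \<Rightarrow> bool" where
  "conjugate_pair N M \<alpha> \<alpha>' w w' \<longleftrightarrow>
     star_hom N M \<alpha> \<and> star_hom M N \<alpha>' \<and>
     w \<in> Hom N N id (\<alpha>' \<circ> \<alpha>) \<and> w' \<in> Hom M M id (\<alpha> \<circ> \<alpha>') \<and>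
     adj w * \<alpha>' w' = 1 \<and> \<alpha> (adj w) * w' = 1"

definition conjugate :: "'h::chilbert_space bop set \<Rightarrow> 'k::chilbert_space bop set \<Rightarrow>
    ('h bop \<Rightarrow> 'k bop) \<Rightarrow> ('k bop \<Rightarrow> 'h bop) \<Rightarrow> bool" where
  "conjugate N M \<alpha> \<alpha>' \<longleftrightarrow> (\<exists>w w'. conjugate_pair N M \<alpha> \<alpha>' w w')"

definition dim_values :: "'h::chilbert_space bop set \<Rightarrow> 'k::chilbert_space bop set \<Rightarrow>
    ('h bop \<Rightarrow> 'k bop) \<Rightarrow> real set" where
  "dim_values N M \<alpha> = {d. \<exists>\<alpha>' w w'. conjugate_pair N M \<alpha> \<alpha>' w w' \<and>
     adj w * w = complex_of_real d *\<^sub>C 1 \<and> adj w' * w' = complex_of_real d *\<^sub>C 1}"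

definition finite_dim :: "'h::chilbert_space bop set \<Rightarrow> 'k::chilbert_space bop set \<Rightarrow>
    ('h bop \<Rightarrow> 'k bop) \<Rightarrow> bool" where
  "finite_dim N M \<alpha> \<longleftrightarrow> dim_values N M \<alpha> \<noteq> {}"

text \<open>Only meaningful if \<open>finite_dim N M \<alpha>\<close> holds.\<close>

definition hom_dim :: "'h::chilbert_space bop set \<Rightarrow> 'k::chilbert_space bop set \<Rightarrow>
    ('h bop \<Rightarrow> 'k bop) \<Rightarrow> real" where
  "hom_dim N M \<alpha> = Inf (dim_values N M \<alpha>)"

definition standard_pair :: "'h::chilbert_space bop set \<Rightarrow> 'k::chilbert_space bop set \<Rightarrow>
    ('h bop \<Rightarrow> 'k bop) \<Rightarrow> ('k bop \<Rightarrow> 'h bop) \<Rightarrow> 'h bop \<Rightarrow> 'k bop \<Rightarrow> bool" where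
  "standard_pair N M \<alpha> \<alpha>' w w' \<longleftrightarrow> conjugate_pair N M \<alpha> \<alpha>' w w' \<and>
     adj w * w = complex_of_real (hom_dim N M \<alpha>) *\<^sub>C 1 \<and>
     adj w' * w' = complex_of_real (hom_dim N M \<alpha>) *\<^sub>C 1"


section \<open>Subobjects, direct sums and tensor subcategories\<close>

text \<open>\<open>\<beta>\<close> is a representative of the range of \<open>e\<close>. For \<open>e = 0\<close> there is none.\<close>

definition range_of_proj :: "'h::chilbert_space bop set \<Rightarrow> 'k::chilbert_space bop set \<Rightarrow>
    ('h bop \<Rightarrow> 'k bop) \<Rightarrow> 'k bop \<Rightarrow> ('h bop \<Rightarrow> 'k bop) \<Rightarrow> bool" where
  "range_of_proj N M \<alpha> e \<beta> \<longleftrightarrow> e \<in> Hom N M \<alpha> \<alpha> \<and> is_proj e \<and>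
     (\<exists>s\<in>M. is_isometry s \<and> s * adj s = e \<and> (\<forall>n\<in>N. \<beta> n = adj s * \<alpha> n * s))"

definition subobject :: "'h::chilbert_space bop set \<Rightarrow> 'k::chilbert_space bop set \<Rightarrow>
    ('h bop \<Rightarrow> 'k bop) \<Rightarrow> ('h bop \<Rightarrow> 'k bop) \<Rightarrow> bool" where
  "subobject N M \<beta> \<alpha> \<longleftrightarrow> (\<exists>e. range_of_proj N M \<alpha> e \<beta>)"

definition unitarily_equivalent :: "'h::chilbert_space bop set \<Rightarrow> 'k::chilbert_space bop set \<Rightarrow>
    ('h bop \<Rightarrow> 'k bop) \<Rightarrow> ('h bop \<Rightarrow> 'k bop) \<Rightarrow> bool" where
  "unitarily_equivalent N M \<alpha> \<beta> \<longleftrightarrow> (\<exists>u. is_unitary u \<and> u \<in> Hom N M \<alpha> \<beta>)"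

definition direct_sum :: "'h::chilbert_space bop set \<Rightarrow> 'k::chilbert_space bop set \<Rightarrow>
    ('h bop \<Rightarrow> 'k bop) \<Rightarrow> ('h bop \<Rightarrow> 'k bop) \<Rightarrow> ('h bop \<Rightarrow> 'k bop) \<Rightarrow> bool" where
  "direct_sum N M \<alpha> \<alpha>1 \<alpha>2 \<longleftrightarrow> star_hom N M \<alpha> \<and> star_hom N M \<alpha>1 \<and> star_hom N M \<alpha>2 \<and>
     (\<exists>s1\<in>M. \<exists>s2\<in>M. is_isometry s1 \<and> is_isometry s2 \<and> adj s1 * s2 = 0 \<and>
        s1 * adj s1 + s2 * adj s2 = 1 \<and>
        (\<forall>n\<in>N. \<alpha> n = s1 * \<alpha>1 n * adj s1 + s2 * \<alpha>2 n * adj s2))"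

text \<open>A full subcategory is given by its set of objects.\<close>

definition tensor_subcategory :: "'h::chilbert_space bop set \<Rightarrow> ('h bop \<Rightarrow> 'h bop) set \<Rightarrow> bool"
  where
  "tensor_subcategory N C \<longleftrightarrow>
     (\<forall>\<alpha>\<in>C. star_hom N N \<alpha> \<and> finite_dim N N \<alpha>) \<and>
     id \<in> C \<and> (\<forall>\<alpha>\<in>C. \<forall>\<beta>\<in>C. \<alpha> \<circ> \<beta> \<in> C) \<and>
     (\<forall>\<alpha>1\<in>C. \<forall>\<alpha>2\<in>C. \<forall>\<alpha>. direct_sum N N \<alpha> \<alpha>1 \<alpha>2 \<longrightarrow> \<alpha> \<in> C) \<and>
     (\<forall>\<alpha>\<in>C. \<forall>\<beta>. subobject N N \<beta> \<alpha> \<longrightarrow> \<beta> \<in> C) \<and>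
     (\<forall>\<alpha>\<in>C. \<forall>\<beta>. conjugate N N \<alpha> \<beta> \<longrightarrow> \<beta> \<in> C)"


section \<open>Q-systems\<close>

definition Q_system :: "'h::chilbert_space bop set \<Rightarrow> ('h bop \<Rightarrow> 'h bop) set \<Rightarrow>
    ('h bop \<Rightarrow> 'h bop) \<Rightarrow> 'h bop \<Rightarrow> 'h bop \<Rightarrow> bool" where
  "Q_system N C \<theta> w x \<longleftrightarrow>
     \<theta> \<in> C \<and> w \<in> Hom N N id \<theta> \<and> x \<in> Hom N N \<theta> (\<theta> \<circ> \<theta>) \<and>
     hprod \<theta> (adj w) 1 * x = 1 \<and> hprod \<theta> 1 (adj w) * x = 1 \<and>
     hprod \<theta> x 1 * x = hprod \<theta> 1 x * x \<and>
     hprod \<theta> 1 (adj x) * hprod \<theta> x 1 = x * adj x \<and>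
     x * adj x = hprod (\<theta> \<circ> \<theta>) (adj x) 1 * hprod \<theta> 1 x \<and>
     adj w * w = complex_of_real (sqrt (hom_dim N N \<theta>)) *\<^sub>C 1 \<and>
     adj x * x = complex_of_real (sqrt (hom_dim N N \<theta>)) *\<^sub>C 1"

text \<open>\<open>M\<close> (on an arbitrary Hilbert space), \<open>\<iota>\<close> and \<open>v\<close> form a realization of the extension of
  \<open>N\<close> by \<open>(\<theta>, w, x)\<close>, and \<open>\<iota>'\<close> is the conjugate of \<open>\<iota>\<close>.\<close>

definition Q_extension :: "'h::chilbert_space bop set \<Rightarrow> ('h bop \<Rightarrow> 'h bop) \<Rightarrow> 'h bop \<Rightarrow>
    'h bop \<Rightarrow> 'k::chilbert_space bop set \<Rightarrow> ('h bop \<Rightarrow> 'k bop) \<Rightarrow> 'k bop \<Rightarrow>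
    ('k bop \<Rightarrow> 'h bop) \<Rightarrow> bool" where
  "Q_extension N \<theta> w x M \<iota> v \<iota>' \<longleftrightarrow>
     von_neumann_algebra M \<and> star_hom N M \<iota> \<and> v \<in> M \<and>
     (\<forall>m\<in>M. \<exists>!n. n \<in> N \<and> m = \<iota> n * v) \<and>
     (\<forall>n\<in>N. v * \<iota> n = \<iota> (\<theta> n) * v) \<and>
     v * v = \<iota> x * v \<and> adj v = \<iota> (adj w * adj x) * v \<and> 1 = \<iota> (adj w) * v \<and>
     (\<forall>n\<in>N. \<iota>' (\<iota> n * v) = \<theta> n * x)"

definition Q_equivalent :: "'h::chilbert_space bop set \<Rightarrow>
    ('h bop \<Rightarrow> 'h bop) \<Rightarrow> 'h bop \<Rightarrow> 'h bop \<Rightarrow>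
    ('h bop \<Rightarrow> 'h bop) \<Rightarrow> 'h bop \<Rightarrow> 'h bop \<Rightarrow> bool" where
  "Q_equivalent N \<theta>1 w1 x1 \<theta>2 w2 x2 \<longleftrightarrow>
     (\<exists>u. is_unitary u \<and> u \<in> Hom N N \<theta>1 \<theta>2 \<and> w2 = u * w1 \<and> x2 * u = hprod \<theta>1 u u * x1)"

definition Q_system_of_hom :: "'h::chilbert_space bop set \<Rightarrow> 'k::chilbert_space bop set \<Rightarrow>
    ('h bop \<Rightarrow> 'k bop) \<Rightarrow> ('h bop \<Rightarrow> 'h bop) \<Rightarrow> 'h bop \<Rightarrow> 'h bop \<Rightarrow> bool" where
  "Q_system_of_hom N M \<phi> \<theta> w x \<longleftrightarrow> star_hom N M \<phi> \<and> finite_dim N M \<phi> \<and>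
     (\<exists>\<phi>' w\<phi> v\<phi>. standard_pair N M \<phi> \<phi>' w\<phi> v\<phi> \<and>
        Q_equivalent N (\<phi>' \<circ> \<phi>) w\<phi> (\<phi>' v\<phi>) \<theta> w x)"


section \<open>Reducing projections of a Q-system\<close>

definition right_reducing :: "'h::chilbert_space bop set \<Rightarrow> ('h bop \<Rightarrow> 'h bop) \<Rightarrow> 'h bop \<Rightarrow>
    'h bop \<Rightarrow> 'h bop \<Rightarrow> bool" where
  "right_reducing N \<theta> w x p \<longleftrightarrow> p \<in> Hom N N \<theta> \<theta> \<and> is_proj p \<and>
     hprod \<theta> 1 p * x = x * p \<and> p * w = hprod \<theta> (adj w * p) 1 * x * w"

definition left_reducing :: "'h::chilbert_space bop set \<Rightarrow> ('h bop \<Rightarrow> 'h bop) \<Rightarrow> 'h bop \<Rightarrow>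
    'h bop \<Rightarrow> 'h bop \<Rightarrow> bool" where
  "left_reducing N \<theta> w x q \<longleftrightarrow> q \<in> Hom N N \<theta> \<theta> \<and> is_proj q \<and>
     hprod \<theta> q 1 * x = x * q \<and> q * w = hprod \<theta> 1 (adj w * q) * x * w"

text \<open>Here \<open>x\<^sup>(\<^sup>2\<^sup>) = (x \<times> 1) x\<close>, and \<open>w\<^sup>*P \<times> 1 \<times> w\<^sup>*P\<close> is bracketed to the right.\<close>

definition two_sided_reducing :: "'h::chilbert_space bop set \<Rightarrow> ('h bop \<Rightarrow> 'h bop) \<Rightarrow> 'h bop \<Rightarrow>
    'h bop \<Rightarrow> 'h bop \<Rightarrow> bool" where
  "two_sided_reducing N \<theta> w x P \<longleftrightarrow> P \<in> Hom N N \<theta> \<theta> \<and> is_proj P \<and>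
     hprod \<theta> (adj w * P) (hprod \<theta> 1 (adj w * P)) * (hprod \<theta> x 1 * x) = P"

end

theory Submission
  imports Defs
begin

text \<open>A reducing projection of any of the three kinds comes from a projection \<open>e\<close>
  of \<open>Hom \<iota> \<iota>\<close>: one has \<open>p = \<iota>' e\<close>, \<open>q\<close> is the conjugate of \<open>e\<close> with respect to the pair
  \<open>(w, v)\<close>, and \<open>P = q p\<close> is the corner of \<open>\<iota>' \<circ> \<iota>\<close> cut out by both. The algebraic identities are
  then manipulations of intertwiners. The dimensions are controlled as follows. If \<open>\<alpha>\<close> has a
  minimal pair of value \<open>d\<close>, then perturbing the pair along \<open>e\<close> shows that \<open>e\<close> and its conjugate
  have the same value \<open>c\<close>; and a pair of value \<open>D\<close> for the range of \<open>e\<close> can be completed to a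
  pair of value \<open>D + (d - c)\<close> for \<open>\<alpha>\<close>, so that \<open>c\<close> is minimal for the range of \<open>e\<close>. This is applied to
  \<open>(\<iota>, e)\<close> and to \<open>(\<theta>, P)\<close>, where \<open>P\<close> has value \<open>c\<^sup>2\<close>. Isometries with prescribed
  range come from Frobenius reciprocity and a Cantor--Bernstein argument.\<close>

section \<open>Hilbert spaces and adjoints\<close>

text \<open>The dimension is an infimum over all conjugates and all pairs, so a value must be
  bounded below against arbitrary competitors. A Q-system normalises \<open>w\<close> and
  \<open>x\<close> only against \<open>hom_dim N N \<theta>\<close>; minimality of the pair
  \<open>(w, v)\<close> for \<iota> therefore has to be derived. A competitor of value D for
  \<iota>, nested with \<open>(w, v)\<close>, is a competitor of value d * D for \<theta>, whose
  minimum is d * d. The square in the value of \<open>P\<close> has the same origin: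
  \<open>P\<close> cuts both legs of \<theta>, and each leg contributes one closed loop.

  The second clause in (a) and (b) concerns adjoints. Rotating \<open>e\<close> around the pair
  gives \<open>q\<close>, but the adjoint of \<open>q\<close> is a rotation in the opposite sense.
  For \<open>e\<close> a projection with \<open>p = \<iota>' e\<close>, the two agree exactly when
  \<open>p * w = q * w\<close>. In (c) this has to be extracted from self-adjointness of
  \<open>P\<close>.\<close>

lemma cinner_add_left: "cinner (x + y) z = cinner x z + cinner y (z::'a::chilbert_space)"
  by (metis cinner_commute cinner_add_right complex_cnj_add)

lemma cinner_scaleC_left: "cinner (a *\<^sub>C x) y = cnj a * cinner x (y::'a::chilbert_space)"
  by (metis cinner_commute cinner_scaleC_right complex_cnj_mult)

lemma cinner_zero_right [simp]: "cinner x (0::'a::chilbert_space) = 0"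
  using cinner_add_right[of x 0 0] by simp

lemma cinner_zero_left [simp]: "cinner (0::'a::chilbert_space) x = 0"
  using cinner_add_left[of 0 0 x] by simp

lemma cinner_minus_right: "cinner x (- y) = - cinner x (y::'a::chilbert_space)"
  using cinner_add_right[of x "- y" y] by (simp add: eq_neg_iff_add_eq_0)

lemma cinner_minus_left: "cinner (- x) y = - cinner x (y::'a::chilbert_space)"
  using cinner_add_left[of "- x" x y] by (simp add: eq_neg_iff_add_eq_0)

lemma cinner_diff_right: "cinner x (y - z) = cinner x y - cinner x (z::'a::chilbert_space)"
  using cinner_add_right[of x y "- z"] by (simp add: cinner_minus_right)

lemma cinner_diff_left: "cinner (x - y) z = cinner x z - cinner y (z::'a::chilbert_space)"
  using cinner_add_left[of x "- y" z] by (simp add: cinner_minus_left)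

lemma cinner_scaleR_right: "cinner x (r *\<^sub>R y) = r * cinner x (y::'a::chilbert_space)"
  by (simp add: scaleR_scaleC cinner_scaleC_right)

lemma cinner_scaleR_left: "cinner (r *\<^sub>R x) y = r * cinner x (y::'a::chilbert_space)"
  by (simp add: scaleR_scaleC cinner_scaleC_left)

lemmas cinner_linear = cinner_add_left cinner_add_right cinner_diff_left cinner_diff_right
  cinner_scaleC_left cinner_scaleC_right cinner_scaleR_left cinner_scaleR_right

lemma norm_sq_cinner: "(norm x)\<^sup>2 = Re (cinner x (x::'a::chilbert_space))"
  using norm_cinner[of x] by (metis norm_ge_zero real_sqrt_ge_0_iff real_sqrt_pow2)

lemma cinner_self: "cinner x x = complex_of_real ((norm (x::'a::chilbert_space))\<^sup>2)"
proof -
  have "Im (cinner x x) = 0"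
    using arg_cong[OF cinner_commute[of x x], of Im] by simp
  then show ?thesis by (simp add: complex_eq_iff norm_sq_cinner)
qed

lemma cinner_self_zero: "cinner x x = 0 \<longleftrightarrow> x = (0::'a::chilbert_space)"
  by (simp add: cinner_self)

lemma cinner_ext: "(\<And>z. cinner z x = cinner z y) \<Longrightarrow> x = (y::'a::chilbert_space)"
  using cinner_self_zero[of "x - y"] by (simp add: cinner_diff_right)

lemma Re_cinner_commute: "Re (cinner x y) = Re (cinner y (x::'a::chilbert_space))"
  using cinner_commute[of x y] by simp

lemma norm_add_sq: "(norm (x + y))\<^sup>2 = (norm x)\<^sup>2 + 2 * Re (cinner x y) + (norm (y::'a::chilbert_space))\<^sup>2"
  by (simp add: norm_sq_cinner cinner_linear Re_cinner_commute[of y x])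

lemma norm_diff_sq: "(norm (x - y))\<^sup>2 = (norm x)\<^sup>2 - 2 * Re (cinner x y) + (norm (y::'a::chilbert_space))\<^sup>2"
  by (simp add: norm_sq_cinner cinner_linear Re_cinner_commute[of y x])

text \<open>A nonzero linear term would win for small t; t = - b / c with c > a and c > 0 is small
  enough to make the expression negative.\<close>

lemma linear_coeff_zero:
  fixes a b :: real
  assumes "\<And>t. 0 \<le> t\<^sup>2 * a + 2 * t * b"
  shows "b = 0"
proof (rule ccontr)
  assume b: "b \<noteq> 0"
  define c where "c = \<bar>a\<bar> + 1"
  have c: "c > 0" "a < c" by (auto simp: c_def)
  have "0 \<le> (- b / c)\<^sup>2 * a + 2 * (- b / c) * b" by (rule assms)
  also have "\<dots> = b\<^sup>2 / c * (a / c - 2)"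
    using c by (simp add: field_simps power2_eq_square)
  finally have "0 \<le> a / c - 2"
    using b c by (simp add: zero_le_mult_iff zero_le_divide_iff)
  then show False using c by (simp add: field_simps)
qed

lemma cauchy_schwarz_Re: "\<bar>Re (cinner x y)\<bar> \<le> norm x * norm (y::'a::chilbert_space)"
proof -
  have *: "Re (cinner x y) \<le> norm x * norm y" for x y :: 'a
  proof (cases "norm x = 0 \<or> norm y = 0")
    case True
    then show ?thesis by auto
  next
    case False
    define X where "X = norm x"
    define Y where "Y = norm y"
    have "0 < X" "0 < Y" using False by (auto simp: X_def Y_def)
    have "0 \<le> (norm (Y *\<^sub>R x - X *\<^sub>R y))\<^sup>2" by simp
    also have "\<dots> = 2 * (X * Y) * (X * Y - Re (cinner x y))"
      unfolding norm_diff_sq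
      by (simp add: cinner_linear X_def Y_def power_mult_distrib) (simp add: power2_eq_square algebra_simps)
    finally have "0 \<le> X * Y - Re (cinner x y)"
      using mult_pos_pos[OF \<open>0 < X\<close> \<open>0 < Y\<close>] by (simp add: zero_le_mult_iff)
    then show ?thesis by (simp add: X_def Y_def)
  qed
  show ?thesis using *[of x y] *[of "- x" y] by (simp add: cinner_minus_left abs_le_iff)
qed

text \<open>The factor 2 comes from estimating real and imaginary part separately. Only boundedness
  is ever drawn from it.\<close>

lemma cauchy_schwarz: "cmod (cinner x y) \<le> 2 * (norm x * norm (y::'a::chilbert_space))"
proof -
  have "Im (cinner x y) = Re (cinner (\<i> *\<^sub>C x) y)"
    by (simp add: cinner_scaleC_left)
  then have "\<bar>Im (cinner x y)\<bar> \<le> norm x * norm y"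
    using cauchy_schwarz_Re[of "\<i> *\<^sub>C x" y] by (simp add: norm_scaleC)
  then show ?thesis
    using cmod_le[of "cinner x y"] cauchy_schwarz_Re[of x y] by linarith
qed

section \<open>Minimisation over closed subspaces and Riesz representation\<close>

definition closed_subspace :: "'a::chilbert_space set \<Rightarrow> bool" where
  "closed_subspace G \<longleftrightarrow> closed G \<and> 0 \<in> G \<and> (\<forall>x\<in>G. \<forall>y\<in>G. x + y \<in> G) \<and> (\<forall>c. \<forall>x\<in>G. c *\<^sub>C x \<in> G)"

text \<open>Minimising \<open>\<parallel>x\<parallel>\<^sup>2 - 2 Re f(x)\<close> over \<open>G\<close> yields both the Riesz representation theorem
  (\<open>G = UNIV\<close>) and orthogonal projections (\<open>f = cinner y\<close>).\<close>

lemma riesz_on_closed_subspace: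
  fixes f :: "'a::chilbert_space \<Rightarrow> complex"
  assumes G: "closed_subspace G"
    and f_add: "\<And>x y. f (x + y) = f x + f y"
    and f_scale: "\<And>c x. f (c *\<^sub>C x) = c * f x"
    and f_bound: "\<And>x. cmod (f x) \<le> K * norm x"
  shows "\<exists>z\<in>G. \<forall>x\<in>G. cinner z x = f x"
proof -
  have Gcl: "closed G" and G0: "0 \<in> G" and Gadd: "\<And>x y. x \<in> G \<Longrightarrow> y \<in> G \<Longrightarrow> x + y \<in> G"
    and Gsc: "\<And>c x. x \<in> G \<Longrightarrow> c *\<^sub>C x \<in> G"
    using G by (auto simp: closed_subspace_def)
  have GscR: "r *\<^sub>R x \<in> G" if "x \<in> G" for r x using Gsc[OF that] by (simp add: scaleR_scaleC)
  define g where "g x = Re (f x)" for x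
  have g_add: "g (x + y) = g x + g y" for x y by (simp add: g_def f_add)
  have g_scR: "g (r *\<^sub>R x) = r * g x" for r x by (simp add: g_def scaleR_scaleC f_scale)
  have g_bound: "\<bar>g x\<bar> \<le> K * norm x" for x
    unfolding g_def using abs_Re_le_cmod[of "f x"] f_bound[of x] by linarith
  have gbl: "bounded_linear g"
    by (rule bounded_linear_intro[of _ K]) (use g_add g_scR g_bound in \<open>auto simp: mult.commute\<close>)
  define J where "J x = (norm x)\<^sup>2 - 2 * g x" for x
  have J_cont: "(J \<circ> X) \<longlonglongrightarrow> J z" if "X \<longlonglongrightarrow> z" for X z
    unfolding J_def comp_def
    by (intro tendsto_intros that bounded_linear.tendsto[OF gbl])
  have J_lower: "- K\<^sup>2 \<le> J x" for x
  proof -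
    have "0 \<le> (norm x - K)\<^sup>2" by simp
    then have "- K\<^sup>2 \<le> (norm x)\<^sup>2 - 2 * (K * norm x)" by (simp add: power2_diff algebra_simps)
    then show ?thesis using g_bound[of x] by (simp add: J_def abs_le_iff)
  qed
  have bdd: "bdd_below (J ` G)" by (rule bdd_belowI2[of _ "- K\<^sup>2"]) (rule J_lower)
  define m where "m = Inf (J ` G)"
  have m_le: "m \<le> J x" if "x \<in> G" for x
    unfolding m_def using bdd that by (intro cInf_lower) auto
  have "\<exists>x\<in>G. J x < m + 1 / real (Suc n)" for n
  proof -
    have "Inf (J ` G) < m + 1 / real (Suc n)" by (simp add: m_def)
    then show ?thesis using cInf_less_iff[of "J ` G"] bdd G0 by auto
  qed
  then obtain X where X: "\<And>n. X n \<in> G" "\<And>n. J (X n) < m + 1 / real (Suc n)" by metis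
  \<comment> \<open>Parallelogram law: the midpoint stays in \<open>G\<close>, so two
    near-minimisers are close to each other.\<close>
  have par: "(norm (x - y))\<^sup>2 \<le> 2 * (J x + J y - 2 * m)" if "x \<in> G" "y \<in> G" for x y
  proof -
    have "J x + J y = 2 * J ((1/2) *\<^sub>R (x + y)) + (norm (x - y))\<^sup>2 / 2"
      unfolding J_def norm_diff_sq
      by (simp add: g_scR g_add power_mult_distrib norm_add_sq power_divide) (simp add: field_simps)
    moreover have "m \<le> J ((1/2) *\<^sub>R (x + y))" by (intro m_le GscR Gadd that)
    ultimately show ?thesis
      by (simp only: distrib_left right_diff_distrib)
  qed
  have "Cauchy X"
  proof (rule CauchyI)
    fix r :: real assume "0 < r"
    then obtain n0 where n0: "inverse (real (Suc n0)) < r\<^sup>2 / 4"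
      using reals_Archimedean[of "r\<^sup>2 / 4"] by auto
    have "norm (X i - X j) < r" if "n0 \<le> i" "n0 \<le> j" for i j
    proof -
      have i: "1 / real (Suc i) \<le> 1 / real (Suc n0)" "1 / real (Suc j) \<le> 1 / real (Suc n0)"
        using that by (auto intro!: divide_left_mono)
      have "(norm (X i - X j))\<^sup>2 \<le> 2 * (J (X i) + J (X j) - 2 * m)" by (rule par; rule X)
      also have "\<dots> < r\<^sup>2" using X(2)[of i] X(2)[of j] i n0 by (simp add: inverse_eq_divide)
      finally show ?thesis using \<open>0 < r\<close> by (meson less_imp_le power_less_imp_less_base)
    qed
    then show "\<exists>M. \<forall>i\<ge>M. \<forall>j\<ge>M. norm (X i - X j) < r" by blast
  qed
  then obtain z where z: "X \<longlonglongrightarrow> z" using Cauchy_convergent_iff convergent_def by blast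
  have zG: "z \<in> G" using Gcl X(1) z closed_sequentially by blast
  have "J z \<le> m"
  proof (rule LIMSEQ_le[OF J_cont[OF z]])
    show "(\<lambda>n. m + 1 / real (Suc n)) \<longlonglongrightarrow> m"
      using tendsto_add[OF tendsto_const LIMSEQ_inverse_real_of_nat, of m]
      by (simp add: inverse_eq_divide)
    show "\<exists>N. \<forall>n\<ge>N. (J \<circ> X) n \<le> m + 1 / real (Suc n)"
      using X(2) by (auto intro: less_imp_le)
  qed
  then have zmin: "J z \<le> J y" if "y \<in> G" for y using m_le[OF that] by linarith
  \<comment> \<open>First variation of \<open>J\<close> at the minimiser in the direction h; the
    imaginary part is obtained afterwards from the direction \<i> h.\<close>
  have re: "Re (cinner z h) = g h" if h: "h \<in> G" for h
  proof -
    have "0 \<le> t\<^sup>2 * (norm h)\<^sup>2 + 2 * t * (Re (cinner z h) - g h)" for t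
    proof -
      have "J z \<le> J (z + t *\<^sub>R h)" by (intro zmin Gadd zG GscR h)
      then show ?thesis
        unfolding J_def norm_add_sq
        by (simp add: g_add g_scR cinner_linear power_mult_distrib algebra_simps)
    qed
    from linear_coeff_zero[OF this] show ?thesis by simp
  qed
  have "cinner z h = f h" if h: "h \<in> G" for h
    using re[OF h] re[OF Gsc[OF h, of "\<i>"]]
    by (simp add: complex_eq_iff g_def f_scale cinner_linear)
  with zG show ?thesis by blast
qed

lemma closed_subspace_UNIV: "closed_subspace UNIV"
  by (simp add: closed_subspace_def)

section \<open>Bounded operators, adjoints and projections onto closed subspaces\<close>

lemma bop_eqI: "(\<And>x. apply_bop A x = apply_bop B x) \<Longrightarrow> A = B"
  by (metis apply_bop_inject ext)

lemma apply_bop_linear: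
  "apply_bop A (x + y) = apply_bop A x + apply_bop A y"
  "apply_bop A (x - y) = apply_bop A x - apply_bop A y"
  "apply_bop A (c *\<^sub>C x) = c *\<^sub>C apply_bop A x"
  "apply_bop A 0 = 0"
  using apply_bop[of A] by (auto simp: linear_simps)

lemma apply_bop_bounded: "\<exists>K\<ge>0. \<forall>x. norm (apply_bop A x) \<le> K * norm x"
  using apply_bop[of A] bounded_linear.nonneg_bounded[of "apply_bop A"] by (auto simp: mult.commute)

lemma apply_bop_simps [simp]:
  "apply_bop (A * B) x = apply_bop A (apply_bop B x)"
  "apply_bop (A + B) x = apply_bop A x + apply_bop B x"
  "apply_bop (A - B) x = apply_bop A x - apply_bop B x"
  "apply_bop (- A) x = - apply_bop A x"
  "apply_bop (c *\<^sub>C A) x = c *\<^sub>C apply_bop A x"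
  "apply_bop 1 x = x"
  "apply_bop 0 x = 0"
  by (transfer; simp)+

text \<open>Having a formal adjoint already forces linearity, because the inner product is definite;
  only the bound has to be supplied.\<close>

lemma bop_from_form:
  fixes B :: "'a::chilbert_space \<Rightarrow> 'a"
  assumes B: "\<And>x y. cinner (A x) y = cinner x (B y)"
    and bound: "\<And>y. norm (B y) \<le> K * norm y"
  shows "\<exists>T. \<forall>y. apply_bop T y = B y"
proof -
  have add: "B (x + y) = B x + B y" for x y
    by (rule cinner_ext) (simp add: cinner_linear flip: B)
  have sc: "B (c *\<^sub>C x) = c *\<^sub>C B x" for c x
    by (rule cinner_ext) (simp add: cinner_linear flip: B)
  have "bounded_linear B"
    by (rule bounded_linear_intro[of _ K])
      (use add sc bound in \<open>auto simp: mult.commute scaleR_scaleC\<close>)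
  with sc have "apply_bop (Abs_bop B) = B" by (subst Abs_bop_inverse) auto
  then show ?thesis by metis
qed

lemma adj_exists: "\<exists>T. \<forall>x y. cinner (apply_bop A x) y = cinner x (apply_bop T y)"
proof -
  obtain K where K: "K \<ge> 0" "\<And>x. norm (apply_bop A x) \<le> K * norm x"
    using apply_bop_bounded by blast
  have b: "cmod (cinner y (apply_bop A x)) \<le> 2 * norm y * K * norm x" for x y
    using cauchy_schwarz[of y "apply_bop A x"] mult_left_mono[OF K(2)[of x], of "norm y"] by simp
  have "\<exists>z. \<forall>x. cinner z x = cinner y (apply_bop A x)" for y
    using riesz_on_closed_subspace[OF closed_subspace_UNIV, of "\<lambda>x. cinner y (apply_bop A x)"
        "2 * norm y * K"] b by (auto simp: apply_bop_linear cinner_linear)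
  then obtain B where "\<And>y x. cinner (B y) x = cinner y (apply_bop A x)" by metis
  then have B: "cinner (apply_bop A x) y = cinner x (B y)" for x y
    by (metis cinner_commute)
  have "norm (B y) \<le> (2 * K) * norm y" for y
  proof -
    have "(norm (B y))\<^sup>2 = cmod (cinner (B y) (B y))"
      by (simp add: cinner_self norm_power del: of_real_power)
    also have "\<dots> = cmod (cinner (apply_bop A (B y)) y)" by (simp add: B)
    also have "\<dots> \<le> 2 * (norm (apply_bop A (B y)) * norm y)" by (rule cauchy_schwarz)
    also have "\<dots> \<le> 2 * (K * norm (B y) * norm y)" by (simp add: K(2) mult_right_mono)
    finally have "norm (B y) * norm (B y) \<le> norm (B y) * ((2 * K) * norm y)"
      by (simp add: power2_eq_square mult_ac)
    then show ?thesis using K(1)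
      by (cases "norm (B y) = 0") (auto simp: mult_le_cancel_left)
  qed
  from bop_from_form[of "apply_bop A" B, OF B this] show ?thesis using B by metis
qed

lemma adj_unique:
  assumes "\<And>x y. cinner (apply_bop A x) y = cinner x (apply_bop B y)"
  shows "adj A = B"
  unfolding adj_def
proof (rule the_equality)
  fix T assume "\<forall>x y. cinner (apply_bop A x) y = cinner x (apply_bop T y)"
  then show "T = B" by (metis assms bop_eqI cinner_ext)
qed (use assms in blast)

lemma cinner_adj_right: "cinner x (apply_bop (adj A) y) = cinner (apply_bop A x) y"
  using adj_exists[of A] adj_unique[of A] by metis

lemma cinner_adj_left: "cinner (apply_bop (adj A) x) y = cinner x (apply_bop A y)"
  by (metis cinner_commute cinner_adj_right)

lemma adj_adj [simp]: "adj (adj A) = A"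
  by (rule adj_unique) (rule cinner_adj_left)

lemma adj_mult [simp]: "adj (A * B) = adj B * adj A"
  by (rule adj_unique) (simp add: cinner_adj_right)

lemma adj_add [simp]: "adj (A + B) = adj A + adj B"
  by (rule adj_unique) (simp add: cinner_adj_right cinner_linear)

lemma adj_diff [simp]: "adj (A - B) = adj A - adj B"
  by (rule adj_unique) (simp add: cinner_adj_right cinner_linear)

lemma adj_scaleC [simp]: "adj (c *\<^sub>C A) = cnj c *\<^sub>C adj A"
  by (rule adj_unique) (simp add: cinner_adj_right cinner_linear)

lemma adj_one [simp]: "adj 1 = 1"
  by (rule adj_unique) simp

lemma adj_zero [simp]: "adj 0 = 0"
  by (rule adj_unique) simp

lemma scaleC_vec_simps:
  "(0::complex) *\<^sub>C x = (0::'a::chilbert_space)" "1 *\<^sub>C x = x"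
proof -
  show "(0::complex) *\<^sub>C x = (0::'a::chilbert_space)"
    using scaleR_scaleC[of 0 x] by simp
  show "1 *\<^sub>C x = x" using scaleR_scaleC[of 1 x] by simp
qed

lemma scaleC_vec_diff: "c *\<^sub>C (x - y) = c *\<^sub>C x - c *\<^sub>C (y::'a::chilbert_space)"
  using scaleC_add_right[of c x "- y"] by (simp add: scaleC_minus_right)

lemma bop_scaleC [simp]:
  "(c *\<^sub>C A) * B = c *\<^sub>C (A * B)" "A * (c *\<^sub>C B) = c *\<^sub>C (A * B)"
  "a *\<^sub>C (b *\<^sub>C A) = (a * b) *\<^sub>C A" "(1::complex) *\<^sub>C A = A" "(0::complex) *\<^sub>C A = 0"
  "c *\<^sub>C (0 :: 'a bop) = 0"
  for A B :: "'a::chilbert_space bop"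
  by (rule bop_eqI; simp add: apply_bop_linear scaleC_scaleC scaleC_vec_simps scaleC_zero_right)+

lemma bop_scaleC_linear:
  "(a + b) *\<^sub>C A = a *\<^sub>C A + b *\<^sub>C A" "c *\<^sub>C (A + B) = c *\<^sub>C A + c *\<^sub>C B"
  "c *\<^sub>C (A - B) = c *\<^sub>C A - c *\<^sub>C B" "(a - b) *\<^sub>C A = a *\<^sub>C A - b *\<^sub>C A"
  for A B :: "'a::chilbert_space bop"
proof -
  show "(a + b) *\<^sub>C A = a *\<^sub>C A + b *\<^sub>C A" for a b
    by (rule bop_eqI) (simp add: scaleC_add_left)
  from this[of "a - b" b] show "(a - b) *\<^sub>C A = a *\<^sub>C A - b *\<^sub>C A" by simp
qed (rule bop_eqI; simp add: scaleC_add_right scaleC_vec_diff)+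

lemma adj_mult_self_zero: "adj A * A = 0 \<Longrightarrow> A = 0"
  by (metis apply_bop_simps(1,7) bop_eqI cinner_adj_left cinner_self_zero cinner_zero_left)

text \<open>Evaluate on a nonzero vector, which exists because 1 \<noteq> 0. In this way the scalars
  delivered by factoriality below turn out to be non-negative reals.\<close>

lemma adj_mult_self_scalar:
  fixes A :: "'a::chilbert_space bop"
  assumes "adj A * A = c *\<^sub>C 1" "(1::'a bop) \<noteq> 0"
  shows "c = complex_of_real (Re c) \<and> 0 \<le> Re c"
proof -
  obtain x :: 'a where x: "x \<noteq> 0" using assms(2) by (metis apply_bop_simps(6,7) bop_eqI)
  have "c * complex_of_real ((norm x)\<^sup>2) = cinner x (apply_bop (adj A * A) x)"
    unfolding assms(1) by (simp add: cinner_linear cinner_self)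
  also have "\<dots> = complex_of_real ((norm (apply_bop A x))\<^sup>2)"
    by (simp add: cinner_adj_right cinner_self)
  finally have "c = complex_of_real ((norm (apply_bop A x))\<^sup>2 / (norm x)\<^sup>2)"
    using x by (simp add: field_simps)
  then show ?thesis by simp
qed

lemma is_projD: "is_proj e \<Longrightarrow> e * e = e" "is_proj e \<Longrightarrow> adj e = e"
  by (auto simp: is_proj_def)

lemma is_proj_compl: "is_proj e \<Longrightarrow> is_proj (1 - e)"
  by (simp add: is_proj_def algebra_simps)

lemma projection_exists:
  assumes G: "closed_subspace G"
  shows "\<exists>g. is_proj g \<and> (\<forall>x. apply_bop g x \<in> G) \<and> (\<forall>x\<in>G. apply_bop g x = x)"
proof -
  have "\<exists>z\<in>G. \<forall>x\<in>G. cinner z x = cinner y x" for y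
    using riesz_on_closed_subspace[OF G, of "cinner y" "2 * norm y"] cauchy_schwarz[of y]
    by (auto simp: cinner_linear mult.assoc)
  then obtain B where BG: "\<And>y. B y \<in> G" and B: "\<And>y x. x \<in> G \<Longrightarrow> cinner (B y) x = cinner y x"
    by metis
  have sym: "cinner (B x) y = cinner x (B y)" for x y
    by (metis B BG cinner_commute)
  have "norm (B y) \<le> norm y" for y
  proof -
    have "(norm (B y))\<^sup>2 = Re (cinner y (B y))" by (simp add: norm_sq_cinner B BG)
    also have "\<dots> \<le> norm y * norm (B y)" using cauchy_schwarz_Re[of y "B y"] by simp
    finally show ?thesis by (cases "norm (B y) = 0") (auto simp: power2_eq_square)
  qed
  then obtain g where g: "\<And>y. apply_bop g y = B y"
    using bop_from_form[of B B 1] sym by auto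
  have fixG: "B x = x" if x: "x \<in> G" for x
  proof -
    have "x - B x \<in> G"
      using G x BG[of x] unfolding closed_subspace_def
      by (metis (no_types) add_uminus_conv_diff scaleC_minus_right scaleC_vec_simps(2)
          scaleR_minus1_left scaleR_scaleC)
    then have "cinner (x - B x) (x - B x) = 0" by (simp add: cinner_diff_left B)
    then show ?thesis by (simp add: cinner_self_zero)
  qed
  have "adj g = g" by (rule adj_unique) (simp add: g sym)
  moreover have "g * g = g" by (rule bop_eqI) (simp add: g fixG BG)
  ultimately show ?thesis using BG fixG g by (auto simp: is_proj_def)
qed

section \<open>Von Neumann algebras\<close>

text \<open>Lets a rule \<open>a * b = c\<close> fire inside a right-nested product. Rules are
  therefore passed to the simplifier together with their \<open>[THEN mult_cont]\<close>
  versions.\<close>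

lemma mult_cont: "a * b = c \<Longrightarrow> a * (b * z) = c * (z::'a::semigroup_mult)"
  by (metis mult.assoc)

locale vn_algebra =
  fixes N :: "'h::chilbert_space bop set"
  assumes vn: "von_neumann_algebra N"
begin

lemma in_iff: "a \<in> N \<longleftrightarrow> (\<forall>m\<in>commutant N. a * m = m * a)"
proof -
  have "commutant (commutant N) = N" using vn by (simp add: von_neumann_algebra_def)
  then show ?thesis by (auto simp: commutant_def)
qed

lemma closed [simp, intro]:
  "1 \<in> N" "0 \<in> N"
  "a \<in> N \<Longrightarrow> adj a \<in> N"
  "a \<in> N \<Longrightarrow> c *\<^sub>C a \<in> N"
  "a \<in> N \<Longrightarrow> b \<in> N \<Longrightarrow> a + b \<in> N"
  "a \<in> N \<Longrightarrow> b \<in> N \<Longrightarrow> a - b \<in> N"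
  "a \<in> N \<Longrightarrow> b \<in> N \<Longrightarrow> a * b \<in> N"
proof -
  show "a \<in> N \<Longrightarrow> adj a \<in> N" using vn by (auto simp: von_neumann_algebra_def)
  show "a \<in> N \<Longrightarrow> b \<in> N \<Longrightarrow> a * b \<in> N" by (simp add: in_iff) (metis mult.assoc)
qed (auto simp: in_iff algebra_simps)

lemma power_closed [simp, intro]: "a \<in> N \<Longrightarrow> a ^ n \<in> N"
  by (induction n) auto

lemma commutant_adj: "m \<in> commutant N \<Longrightarrow> adj m \<in> commutant N"
  unfolding commutant_def by (simp, metis adj_adj adj_mult closed(3))

text \<open>Invariance gives g m g = m g for all m in the commutant. As the commutant is
  self-adjoint, taking adjoints gives g m g = g m as well.\<close>

lemma projection_closed:
  assumes g: "is_proj g" "\<And>x. apply_bop g x \<in> G" "\<And>x. x \<in> G \<Longrightarrow> apply_bop g x = x"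
    and inv: "\<And>m x. m \<in> commutant N \<Longrightarrow> x \<in> G \<Longrightarrow> apply_bop m x \<in> G"
  shows "g \<in> N"
  unfolding in_iff
proof
  have *: "g * m * g = m * g" if "m \<in> commutant N" for m
    by (rule bop_eqI) (simp add: g inv that)
  fix m assume m: "m \<in> commutant N"
  have "adj (g * adj m * g) = adj (adj m * g)" using *[OF commutant_adj[OF m]] by simp
  then have "g * m * g = g * m" using is_projD[OF g(1)] by (simp add: mult.assoc)
  with *[OF m] show "g * m = m * g" by simp
qed

text \<open>A Cantor--Bernstein argument. The unitary part of the shift \<open>t\<close> acts on the closed subspace
  \<open>G\<close> orthogonal to all \<open>t^n (1 - P)\<close>; the isometry wanted is the identity on \<open>G\<close> and \<open>t\<close> on its
  complement.\<close>

lemma isometry_onto: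
  assumes t: "t \<in> N" "is_isometry t" and P: "P \<in> N" "is_proj P" and Pt: "P * t = t"
  shows "\<exists>s\<in>N. is_isometry s \<and> s * adj s = P"
proof -
  define G where "G = {x. \<forall>n. apply_bop ((1 - P) * (adj t) ^ n) x = 0}"
  have "closed {x. apply_bop A x = 0}" for A :: "'h bop"
    using apply_bop[of A]
    by (intro closed_Collect_eq) (auto intro: bounded_linear.continuous_on)
  then have "closed (\<Inter>n. {x. apply_bop ((1 - P) * (adj t) ^ n) x = 0})"
    by (intro closed_INT) (rule ballI)
  moreover have "(\<Inter>n. {x. apply_bop ((1 - P) * (adj t) ^ n) x = 0}) = G"
    unfolding G_def by blast
  ultimately have "closed G" by (rule back_subst)
  then have G: "closed_subspace G"
    unfolding closed_subspace_def G_def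
    by (simp del: apply_bop_simps add: apply_bop_linear scaleC_zero_right)
  obtain g where g: "is_proj g" "\<And>x. apply_bop g x \<in> G" "\<And>x. x \<in> G \<Longrightarrow> apply_bop g x = x"
    using projection_exists[OF G] by blast
  have gN: "g \<in> N"
  proof (rule projection_closed[OF g])
    fix m x assume m: "m \<in> commutant N" and x: "x \<in> G"
    have "apply_bop ((1 - P) * adj t ^ n) (apply_bop m x) = 0" for n
    proof -
      have "(1 - P) * adj t ^ n * m = m * ((1 - P) * adj t ^ n)"
        using m P t by (simp add: commutant_def)
      then have "apply_bop ((1 - P) * adj t ^ n * m) x = apply_bop (m * ((1 - P) * adj t ^ n)) x"
        by simp
      then show ?thesis using x
        by (simp add: G_def apply_bop_linear)
    qed
    then show "apply_bop m x \<in> G" by (simp add: G_def)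
  qed
  note gg = is_projD[OF g(1)] and PP = is_projD[OF P(2)]
  have tt: "adj t * t = 1" using t by (simp add: is_isometry_def)
  have tP: "adj t * P = adj t" using arg_cong[OF Pt, of adj] PP by simp
  \<comment> \<open>\<open>G\<close> consists of the vectors killed by \<open>1 - P\<close> that
    \<open>adj t\<close> maps back into \<open>G\<close>. Its complement is thus the range of
    \<open>1 - P\<close> plus the image under \<open>t\<close> of that complement, and
    \<open>R\<close> is the projection onto this sum. Once \<open>g = 1 - R\<close> is known,
    \<open>t * (1 - g) * adj t + g = P\<close> is immediate.\<close>
  define R where "R = (1 - P) + t * (1 - g) * adj t"
  have Pt': "(1 - P) * t = 0" "adj t * (1 - P) = 0" using Pt tP by (simp_all add: algebra_simps)
  have G_iff: "x \<in> G \<longleftrightarrow> apply_bop (1 - P) x = 0 \<and> apply_bop (adj t) x \<in> G" for x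
  proof -
    have "(\<forall>n. Q n) \<longleftrightarrow> Q 0 \<and> (\<forall>n. Q (Suc n))" for Q :: "nat \<Rightarrow> bool" by (metis not0_implies_Suc)
    from this[of "\<lambda>n. apply_bop ((1 - P) * (adj t) ^ n) x = 0"] show ?thesis
      unfolding G_def by (simp add: power_Suc2 del: power_Suc)
  qed
  have gfix: "x \<in> G \<longleftrightarrow> apply_bop (1 - g) x = 0" for x
    using g(2)[of x] g(3)[of x] by auto
  have R1: "(1 - P) * R = 1 - P" "(1 - g) * adj t * R = (1 - g) * adj t"
  proof -
    show "(1 - P) * R = 1 - P"
      using PP Pt'(1) mult_cont[OF Pt'(1)] is_projD[OF is_proj_compl[OF P(2)]]
      by (simp only: R_def distrib_left mult.assoc) simp
    show "(1 - g) * adj t * R = (1 - g) * adj t"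
      using Pt'(2) mult_cont[OF tt] is_projD[OF is_proj_compl[OF g(1)]]
        mult_cont[OF is_projD(1)[OF is_proj_compl[OF g(1)]]]
      by (simp only: R_def distrib_left mult.assoc) simp
  qed
  have RR: "R * R = R" and Ra: "adj R = R"
  proof -
    have "R * R = (1 - P) * R + t * ((1 - g) * adj t * R)"
      by (subst (1) R_def) (simp only: distrib_right mult.assoc)
    also have "\<dots> = R" unfolding R1 by (simp add: R_def mult.assoc)
    finally show "R * R = R" .
    show "adj R = R" using PP gg by (simp add: R_def mult.assoc)
  qed
  have kerR: "apply_bop R x = 0 \<longleftrightarrow> x \<in> G" for x
  proof
    assume z: "apply_bop R x = 0"
    have "apply_bop (1 - P) x = 0"
      using arg_cong[OF R1(1), of "\<lambda>A. apply_bop A x"] z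
      by (simp add: apply_bop_linear del: apply_bop_simps(3))
    moreover have "apply_bop (1 - g) (apply_bop (adj t) x) = 0"
      using arg_cong[OF R1(2), of "\<lambda>A. apply_bop A x"] z
      by (simp add: apply_bop_linear del: apply_bop_simps(3))
    ultimately show "x \<in> G" using G_iff gfix by blast
  next
    assume "x \<in> G"
    then have "apply_bop (1 - P) x = 0" "apply_bop (1 - g) (apply_bop (adj t) x) = 0"
      using G_iff gfix by blast+
    moreover have "apply_bop R x
        = apply_bop (1 - P) x + apply_bop t (apply_bop (1 - g) (apply_bop (adj t) x))"
      by (simp add: R_def)
    ultimately show "apply_bop R x = 0" by (simp only: apply_bop_linear add_0)
  qed
  have "R * g = 0" by (rule bop_eqI) (simp add: kerR g)
  then have gR: "g * R = 0" by (metis Ra adj_mult adj_zero gg(2))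
  have R0: "R * (1 - R) = 0" using RR by (simp add: right_diff_distrib)
  have "g * (1 - R) = 1 - R"
  proof (rule bop_eqI)
    fix x
    have "apply_bop R (apply_bop (1 - R) x) = 0"
      using arg_cong[OF R0, of "\<lambda>A. apply_bop A x"] by (simp only: apply_bop_simps(1,7))
    then show "apply_bop (g * (1 - R)) x = apply_bop (1 - R) x"
      unfolding apply_bop_simps(1) by (intro g(3)) (simp only: kerR)
  qed
  then have g_eq: "g = 1 - R" using gR by (simp add: algebra_simps)
  define s where "s = t * (1 - g) + g"
  \<comment> \<open>\<open>adj t\<close> maps \<open>G\<close> into itself, which removes the cross
    terms of \<open>adj s * s\<close>.\<close>
  have tg: "(1 - g) * (adj t * g) = 0"
  proof (rule bop_eqI)
    fix x
    have "apply_bop (adj t) (apply_bop g x) \<in> G" using g(2)[of x] G_iff by blast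
    then show "apply_bop ((1 - g) * (adj t * g)) x = apply_bop 0 x" using gfix by simp
  qed
  have tg': "g * (t * (1 - g)) = 0" using arg_cong[OF tg, of adj] gg by (simp add: mult.assoc)
  have g0: "(1 - g) * g = 0" "g * (1 - g) = 0" using gg by (simp_all add: algebra_simps)
  have as: "adj s = (1 - g) * adj t + g" using gg by (simp add: s_def)
  have "adj s * s = (1 - g) * (adj t * t) * (1 - g) + g * (t * (1 - g)) + (1 - g) * (adj t * g) + g * g"
    unfolding as unfolding s_def by (simp only: distrib_left distrib_right mult.assoc add.assoc)
  also have "\<dots> = 1"
    by (simp only: tt tg tg' mult_1_right is_projD(1)[OF is_proj_compl[OF g(1)]] gg) simp
  finally have iso: "is_isometry s" by (simp add: is_isometry_def)
  have "s * adj s = t * ((1 - g) * (1 - g)) * adj t + g * (1 - g) * adj t + t * ((1 - g) * g) + g * g"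
    unfolding as unfolding s_def by (simp only: distrib_left distrib_right mult.assoc add.assoc)
  also have "\<dots> = t * (1 - g) * adj t + g"
    using is_projD[OF is_proj_compl[OF g(1)]] gg by (simp add: g0)
  also have "\<dots> = P"
    by (subst (2) g_eq) (simp add: R_def)
  finally have "s * adj s = P" .
  moreover have "s \<in> N" using t gN by (simp add: s_def)
  ultimately show ?thesis using iso by blast
qed

end

lemma factor_vn: "factor N \<Longrightarrow> vn_algebra N"
  by (simp add: factor_def vn_algebra_def)

lemma factor_nonzero: "factor (N :: 'h::chilbert_space bop set) \<Longrightarrow> (1::'h bop) \<noteq> 0"
  by (simp add: factor_def)

lemma factor_scalar: "factor M \<Longrightarrow> t \<in> M \<Longrightarrow> (\<And>m. m \<in> M \<Longrightarrow> t * m = m * t) \<Longrightarrow> \<exists>c. t = c *\<^sub>C 1"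
  by (auto simp: factor_def commutant_def)

text \<open>An element of scalar modulus below \<open>P\<close> rescales to an isometry with range
  below \<open>P\<close>; \<open>isometry_onto\<close> then enlarges the range to all of
  \<open>P\<close>.\<close>

lemma factor_isometry_onto:
  assumes M: "factor M" and P: "P \<in> M" "is_proj P" and a: "a \<in> M" "P * a = a" "a \<noteq> 0"
    and c: "adj a * a = c *\<^sub>C 1"
  shows "\<exists>s\<in>M. is_isometry s \<and> s * adj s = P"
proof -
  interpret vn_algebra M using M by (rule factor_vn)
  have c': "c = complex_of_real (Re c)" "0 \<le> Re c"
    using adj_mult_self_scalar[OF c factor_nonzero[OF M]] by auto
  have c0: "Re c \<noteq> 0"
    using adj_mult_self_zero[of a] c a(3) c' by (metis bop_scaleC(5) of_real_0)
  define r where "r = complex_of_real (1 / sqrt (Re c))"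
  have "1 / sqrt (Re c) * (1 / sqrt (Re c)) * Re c = 1" using c0 c'(2) by simp
  moreover have "cnj r * r * complex_of_real (Re c)
      = complex_of_real (1 / sqrt (Re c) * (1 / sqrt (Re c)) * Re c)"
    by (simp only: r_def of_real_mult complex_cnj_complex_of_real)
  ultimately have "cnj r * r * c = 1" by (metis c'(1) of_real_1)
  then have "is_isometry (r *\<^sub>C a)" by (simp add: is_isometry_def c mult_ac)
  then show ?thesis using isometry_onto[of "r *\<^sub>C a" P] a P by simp
qed

section \<open>Conjugate homomorphisms of factors\<close>

lemma star_homD:
  assumes "star_hom N M \<alpha>"
  shows "\<alpha> 1 = 1"
    and "a \<in> N \<Longrightarrow> \<alpha> a \<in> M"
    and "a \<in> N \<Longrightarrow> b \<in> N \<Longrightarrow> \<alpha> (a + b) = \<alpha> a + \<alpha> b"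
    and "a \<in> N \<Longrightarrow> b \<in> N \<Longrightarrow> \<alpha> (a * b) = \<alpha> a * \<alpha> b"
    and "a \<in> N \<Longrightarrow> \<alpha> (c *\<^sub>C a) = c *\<^sub>C \<alpha> a"
    and "a \<in> N \<Longrightarrow> \<alpha> (adj a) = adj (\<alpha> a)"
  using assms by (auto simp: star_hom_def)

lemma star_hom_diff:
  assumes "star_hom N M \<alpha>" "vn_algebra N" "a \<in> N" "b \<in> N"
  shows "\<alpha> (a - b) = \<alpha> a - \<alpha> b"
proof -
  interpret vn_algebra N by fact
  have "\<alpha> (a - b) + \<alpha> b = \<alpha> a" using star_homD(3)[OF assms(1), of "a - b" b] assms by simp
  then show ?thesis by (simp add: algebra_simps)
qed

lemma star_hom_zero:
  assumes "star_hom N M \<alpha>" "vn_algebra N"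
  shows "\<alpha> 0 = 0"
  using star_hom_diff[OF assms, of 0 0] vn_algebra.closed[OF assms(2)] by simp

lemma HomD:
  assumes "t \<in> Hom N M \<alpha> \<beta>"
  shows "t \<in> M" "n \<in> N \<Longrightarrow> t * \<alpha> n = \<beta> n * t"
  using assms by (auto simp: Hom_def)

lemma Hom_adj:
  assumes "t \<in> Hom N M \<alpha> \<beta>" "star_hom N M \<alpha>" "star_hom N M \<beta>" "vn_algebra N" "vn_algebra M"
  shows "adj t \<in> Hom N M \<beta> \<alpha>"
proof -
  interpret N: vn_algebra N by fact
  interpret M: vn_algebra M by fact
  have "adj t * \<beta> n = \<alpha> n * adj t" if "n \<in> N" for n
    using arg_cong[OF HomD(2)[OF assms(1), of "adj n"], of adj] that assms by (simp add: star_homD)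
  then show ?thesis using HomD(1)[OF assms(1)] by (simp add: Hom_def)
qed

lemma star_hom_cong:
  assumes "vn_algebra N" "\<And>n. n \<in> N \<Longrightarrow> \<alpha> n = \<beta> n"
  shows "star_hom N M \<alpha> \<longleftrightarrow> star_hom N M \<beta>"
proof -
  interpret vn_algebra N by fact
  show ?thesis using assms(2) unfolding star_hom_def by (auto simp: image_subset_iff)
qed

text \<open>The composite \<open>\<alpha> \<circ> \<alpha>'\<close> only sees \<alpha> on
  \<open>N\<close> when \<open>\<alpha>'\<close> maps into \<open>N\<close>, hence the case
  distinction; otherwise neither side holds.\<close>

lemma conjugate_pair_cong:
  assumes "vn_algebra N" "\<And>n. n \<in> N \<Longrightarrow> \<alpha> n = \<beta> n"
  shows "conjugate_pair N M \<alpha> \<alpha>' w w' \<longleftrightarrow> conjugate_pair N M \<beta> \<alpha>' w w'"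
proof (cases "star_hom M N \<alpha>' \<and> w \<in> N")
  case True
  interpret vn_algebra N by fact
  have "star_hom N M \<alpha> \<longleftrightarrow> star_hom N M \<beta>" by (rule star_hom_cong) (use assms in auto)
  then show ?thesis unfolding conjugate_pair_def
    using assms(2) star_homD(2)[of M N \<alpha>'] True
    by (auto simp: Hom_def)
next
  case False
  then show ?thesis by (auto simp: conjugate_pair_def Hom_def)
qed

lemma dim_values_cong:
  assumes "vn_algebra N" "\<And>n. n \<in> N \<Longrightarrow> \<alpha> n = \<beta> n"
  shows "dim_values N M \<alpha> = dim_values N M \<beta>"
proof -
  have "conjugate_pair N M \<alpha> = conjugate_pair N M \<beta>"
    using conjugate_pair_cong[where \<alpha> = \<alpha> and \<beta> = \<beta>, OF assms(1)] assms(2) by (intro ext) auto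
  then show ?thesis by (simp add: dim_values_def)
qed

text \<open>For multiplicativity, the \<open>s * adj s = e\<close> arising between the two factors
  commutes with the values of \<alpha> and is absorbed by \<open>s\<close>.\<close>

lemma star_hom_reduced:
  assumes \<alpha>: "star_hom N M \<alpha>" and "vn_algebra N" "vn_algebra M" and e: "e \<in> Hom N M \<alpha> \<alpha>"
    and s: "s \<in> M" "is_isometry s" "s * adj s = e"
  shows "star_hom N M (\<lambda>n. adj s * \<alpha> n * s)"
proof -
  interpret N: vn_algebra N by fact
  interpret M: vn_algebra M by fact
  have ss: "adj s * s = 1" using s by (simp add: is_isometry_def)
  have es: "e * s = s" unfolding s(3)[symmetric] by (simp add: mult.assoc ss)
  have "adj s * \<alpha> a * s * (adj s * \<alpha> b * s) = adj s * (\<alpha> a * \<alpha> b) * s" if "a \<in> N" "b \<in> N" for a b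
  proof -
    have "adj s * \<alpha> a * s * (adj s * \<alpha> b * s) = adj s * \<alpha> a * (e * \<alpha> b) * s"
      by (simp add: s(3)[symmetric] mult.assoc)
    also have "\<dots> = adj s * \<alpha> a * \<alpha> b * s"
      using es HomD(2)[OF e that(2)] by (simp add: mult.assoc)
    finally show ?thesis by (simp add: mult.assoc)
  qed
  then show ?thesis
    using ss s(1) star_homD[OF \<alpha>] unfolding star_hom_def
    by (auto simp: algebra_simps)
qed

lemma conjugate_pair_sym:
  assumes "conjugate_pair N M \<alpha> \<alpha>' w w'" "vn_algebra N" "vn_algebra M"
  shows "conjugate_pair M N \<alpha>' \<alpha> w' w"
proof -
  have st: "star_hom N M \<alpha>" "star_hom M N \<alpha>'" and w: "w \<in> N" "w' \<in> M"
    using assms by (auto simp: conjugate_pair_def Hom_def)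
  interpret N: vn_algebra N by fact
  interpret M: vn_algebra M by fact
  have "adj (\<alpha> (adj w) * w') = 1" "adj (adj w * \<alpha>' w') = 1"
    using assms(1) by (simp_all add: conjugate_pair_def)
  then have "adj w' * \<alpha> w = 1" "\<alpha>' (adj w') * w = 1"
    using st w by (simp_all add: star_homD)
  then show ?thesis using assms(1) by (simp add: conjugate_pair_def)
qed

locale conjugate_factors =
  fixes N :: "'h::chilbert_space bop set" and M :: "'k::chilbert_space bop set"
    and \<alpha> :: "'h bop \<Rightarrow> 'k bop" and \<alpha>' :: "'k bop \<Rightarrow> 'h bop" and w :: "'h bop" and w' :: "'k bop"
  assumes facN: "factor N" and facM: "factor M" and pair: "conjugate_pair N M \<alpha> \<alpha>' w w'"
begin

sublocale N: vn_algebra N by (rule factor_vn[OF facN])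
sublocale M: vn_algebra M by (rule factor_vn[OF facM])

lemma hom: "star_hom N M \<alpha>" and hom': "star_hom M N \<alpha>'"
  using pair by (auto simp: conjugate_pair_def)

lemmas hom_simps [simp] = star_homD[OF hom] star_homD[OF hom']
  star_hom_diff[OF hom N.vn_algebra_axioms] star_hom_diff[OF hom' M.vn_algebra_axioms]
  star_hom_zero[OF hom N.vn_algebra_axioms] star_hom_zero[OF hom' M.vn_algebra_axioms]

lemma w_closed [simp]: "w \<in> N" "w' \<in> M"
  using pair by (auto simp: conjugate_pair_def Hom_def)

lemma dual: "conjugate_factors M N \<alpha>' \<alpha> w' w"
  using conjugate_pair_sym[OF pair N.vn_algebra_axioms M.vn_algebra_axioms] facN facM
  by unfold_locales

lemma w_move:
  "n \<in> N \<Longrightarrow> w * n = \<alpha>' (\<alpha> n) * w" "m \<in> M \<Longrightarrow> w' * m = \<alpha> (\<alpha>' m) * w'"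
  using pair by (auto simp: conjugate_pair_def Hom_def)

lemma adj_w_move:
  "n \<in> N \<Longrightarrow> adj w * \<alpha>' (\<alpha> n) = n * adj w"
  "n \<in> N \<Longrightarrow> adj w * adj (\<alpha>' (\<alpha> n)) = adj n * adj w"
  "m \<in> M \<Longrightarrow> adj w' * \<alpha> (\<alpha>' m) = m * adj w'"
  "m \<in> M \<Longrightarrow> adj w' * adj (\<alpha> (\<alpha>' m)) = adj m * adj w'"
proof -
  show *: "n \<in> N \<Longrightarrow> adj w * adj (\<alpha>' (\<alpha> n)) = adj n * adj w"
    "m \<in> M \<Longrightarrow> adj w' * adj (\<alpha> (\<alpha>' m)) = adj m * adj w'" for n m
    using arg_cong[OF w_move(1)[of n], of adj] arg_cong[OF w_move(2)[of m], of adj] by auto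
  show "n \<in> N \<Longrightarrow> adj w * \<alpha>' (\<alpha> n) = n * adj w" "m \<in> M \<Longrightarrow> adj w' * \<alpha> (\<alpha>' m) = m * adj w'"
    using *(1)[of "adj n"] *(2)[of "adj m"] by auto
qed

lemma conj_eq:
  "adj w * \<alpha>' w' = 1" "adj (\<alpha> w) * w' = 1" "adj (\<alpha>' w') * w = 1" "adj w' * \<alpha> w = 1"
proof -
  show 1: "adj w * \<alpha>' w' = 1" and 2: "adj (\<alpha> w) * w' = 1"
    using pair by (auto simp: conjugate_pair_def)
  show "adj (\<alpha>' w') * w = 1" "adj w' * \<alpha> w = 1"
    using arg_cong[OF 1, of adj] arg_cong[OF 2, of adj] by auto
qed

lemmas w_rules = w_move w_move[THEN mult_cont] adj_w_move adj_w_move[THEN mult_cont]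
  conj_eq conj_eq[THEN mult_cont]

lemma Hom_move:
  assumes "e \<in> Hom N M \<alpha> \<alpha>" "n \<in> N"
  shows "e * \<alpha> n = \<alpha> n * e" "e * adj (\<alpha> n) = adj (\<alpha> n) * e"
  using HomD(2)[OF assms(1), of n] HomD(2)[OF assms(1), of "adj n"] assms(2) by auto

text \<open>This is the loop closed over \<open>e\<close>. An element of \<open>M\<close> passes
  through it, since \<open>w'\<close> turns it into a value of \<alpha>, which commutes with
  \<open>e\<close>; in a factor such an element is scalar.\<close>

lemma scalar_of_Hom:
  assumes e: "e \<in> Hom N M \<alpha> \<alpha>"
  shows "\<exists>c. adj w' * (e * w') = c *\<^sub>C 1"
proof (rule factor_scalar[OF facM])
  show "adj w' * (e * w') \<in> M" using HomD(1)[OF e] by simp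
  show "adj w' * (e * w') * m = m * (adj w' * (e * w'))" if "m \<in> M" for m
    using that by (simp add: mult.assoc w_rules Hom_move[OF e] Hom_move[OF e, THEN mult_cont])
qed

text \<open>The conjugate equation rebuilds \<open>e\<close> as
  \<open>adj (\<alpha> w) * (e * w')\<close>.\<close>

lemma Hom_mult_w'_zero:
  assumes e: "e \<in> Hom N M \<alpha> \<alpha>" and "e * w' = 0"
  shows "e = 0"
proof -
  have "e = e * (adj (\<alpha> w) * w')" by (simp add: conj_eq)
  also have "\<dots> = adj (\<alpha> w) * (e * w')" by (simp add: mult.assoc Hom_move[OF e, THEN mult_cont])
  finally show ?thesis by (simp add: assms)
qed

text \<open>By Frobenius reciprocity a nonzero \<open>e\<close> gives a nonzero vector \<open>e * w'\<close> of
  scalar modulus, so that no comparison theory is needed.\<close>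

lemma isometry_onto_Hom:
  assumes e: "e \<in> Hom N M \<alpha> \<alpha>" "is_proj e" "e \<noteq> 0"
  shows "\<exists>s\<in>M. is_isometry s \<and> s * adj s = e"
proof -
  obtain c where c: "adj w' * (e * w') = c *\<^sub>C 1" using scalar_of_Hom[OF e(1)] by blast
  note ee = is_projD[OF e(2)]
  show ?thesis
  proof (rule factor_isometry_onto[OF facM, where a = "e * w'" and c = c])
    show "e * w' \<noteq> 0" using Hom_mult_w'_zero[OF e(1)] e(3) by blast
    show "adj (e * w') * (e * w') = c *\<^sub>C 1" using ee c by (simp add: mult.assoc mult_cont[OF ee(1)])
  qed (use e HomD(1)[OF e(1)] ee in \<open>auto simp: mult_cont\<close>)
qed

end

text \<open>\<open>fw\<close> and \<open>ew\<close> say that \<open>e\<close>, slid around either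
  cup, becomes \<open>f\<close>. Stated as two relations rather than as a formula for
  \<open>f\<close>, the situation is symmetric under exchanging the two sides and stable under
  complements.\<close>

locale conjugate_projections = conjugate_factors N M \<alpha> \<alpha>' w w'
  for N :: "'h::chilbert_space bop set" and M :: "'k::chilbert_space bop set"
    and \<alpha> \<alpha>' w w' +
  fixes e :: "'k bop" and f :: "'h bop"
  assumes e: "e \<in> Hom N M \<alpha> \<alpha>" "is_proj e" and f: "f \<in> Hom M N \<alpha>' \<alpha>'" "is_proj f"
    and fw: "\<alpha>' e * w = f * w" and ew: "\<alpha> f * w' = e * w'"
begin

lemma ef_closed [simp]: "e \<in> M" "f \<in> N"
  using HomD(1)[OF e(1)] HomD(1)[OF f(1)] by auto

lemmas ef_proj [simp] = is_projD[OF e(2)] is_projD[OF f(2)] mult_cont[OF is_projD(1)[OF e(2)]]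
  mult_cont[OF is_projD(1)[OF f(2)]]

lemma e_right: "n \<in> N \<Longrightarrow> e * \<alpha> n = \<alpha> n * e" "n \<in> N \<Longrightarrow> e * adj (\<alpha> n) = adj (\<alpha> n) * e"
  using Hom_move[OF e(1)] by auto

lemma f_right: "m \<in> M \<Longrightarrow> f * \<alpha>' m = \<alpha>' m * f" "m \<in> M \<Longrightarrow> f * adj (\<alpha>' m) = adj (\<alpha>' m) * f"
  using conjugate_factors.Hom_move[OF dual f(1)] by auto

lemma adj_images: "adj (\<alpha>' e) = \<alpha>' e" "adj (\<alpha> f) = \<alpha> f"
  using hom_simps(6)[of f] hom_simps(12)[of e] by auto

lemma adj_fw: "adj w * \<alpha>' e = adj w * f" "adj w' * \<alpha> f = adj w' * e"
  using arg_cong[OF fw, of adj] arg_cong[OF ew, of adj] by (simp_all add: adj_images)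

lemma complement: "conjugate_projections N M \<alpha> \<alpha>' w w' (1 - e) (1 - f)"
proof (unfold_locales)
  show "1 - e \<in> Hom N M \<alpha> \<alpha>" using e_right by (auto simp: Hom_def algebra_simps)
  show "1 - f \<in> Hom M N \<alpha>' \<alpha>'" using f_right by (auto simp: Hom_def algebra_simps)
qed (auto simp: is_proj_compl e f fw ew left_diff_distrib)

lemma dual_projections: "conjugate_projections M N \<alpha>' \<alpha> w' w f e"
  using dual e f fw ew by (auto simp: conjugate_projections_def conjugate_projections_axioms_def)

text \<open>Perturbing a pair by \<open>1 + (a - 1) f\<close>, whose inverse is \<open>1 + (1 / a - 1) f\<close>.\<close>

lemma perturbed_pair:
  fixes a b :: real
  assumes ab: "a * b = 1"
  defines "k \<equiv> 1 - f + complex_of_real a *\<^sub>C f" and "l \<equiv> 1 - e + complex_of_real b *\<^sub>C e"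
  shows "conjugate_pair N M \<alpha> \<alpha>' (k * w) (l * w')"
    and "adj (k * w) * (k * w) = adj w * w - adj w * f * w + complex_of_real (a * a) *\<^sub>C (adj w * f * w)"
proof -
  have ab': "complex_of_real a * complex_of_real b = 1" unfolding of_real_mult[symmetric] ab by simp
  define k' where "k' = 1 - f + complex_of_real b *\<^sub>C f"
  have kk': "k * k' = 1" "k' * k = 1"
    using ab' by (simp_all add: k_def k'_def algebra_simps)
  have adj_k: "adj k = k" "adj l = l" by (simp_all add: k_def l_def)
  have km: "k * \<alpha>' m = \<alpha>' m * k" if "m \<in> M" for m
    using that by (simp add: k_def algebra_simps f_right)
  have lm: "l * \<alpha> n = \<alpha> n * l" if "n \<in> N" for n
    using that by (simp add: l_def algebra_simps e_right)
  have mem: "k \<in> N" "l \<in> M" "k' \<in> N" by (simp_all add: k_def l_def k'_def)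
  \<comment> \<open>Slid around \<open>w'\<close>, the perturbation \<open>l\<close> becomes the
    inverse of \<open>k\<close>; this is what keeps the conjugate equations intact.\<close>
  have lw: "l * w' = \<alpha> k' * w'" by (simp add: l_def k'_def algebra_simps ew)
  have wl: "adj w * \<alpha>' l = adj w * k'"
    by (simp add: l_def k'_def algebra_simps adj_fw)
  have "adj w * k * \<alpha>' (l * w') = adj w * \<alpha>' l * (\<alpha>' w' * k)"
    using mem by (simp add: mult.assoc km km[THEN mult_cont])
  also have "\<dots> = adj w * (k' * \<alpha>' w') * k" by (simp add: wl mult.assoc)
  also have "k' * \<alpha>' w' = \<alpha>' w' * k'" by (simp add: k'_def algebra_simps f_right)
  also have "adj w * (\<alpha>' w' * k') * k = 1" by (simp add: mult.assoc w_rules kk')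
  finally have c1: "adj (k * w) * \<alpha>' (l * w') = 1" by (simp add: adj_k)
  have "adj (\<alpha> w) * \<alpha> k * (l * w') = adj (\<alpha> w) * \<alpha> (k * k') * w'"
    using mem by (simp add: lw mult.assoc)
  then have c2: "\<alpha> (adj (k * w)) * (l * w') = 1" using mem adj_k by (simp add: kk' w_rules)
  show "conjugate_pair N M \<alpha> \<alpha>' (k * w) (l * w')"
    unfolding conjugate_pair_def using hom hom' mem c1 c2
    by (auto simp: Hom_def mult.assoc w_rules km[THEN mult_cont] lm[THEN mult_cont])
  have "k * k = 1 - f + complex_of_real (a * a) *\<^sub>C f" by (simp add: k_def algebra_simps)
  then have "adj (k * w) * (k * w) = adj w * (1 - f + complex_of_real (a * a) *\<^sub>C f) * w"
    by (metis adj_k(1) adj_mult mult.assoc)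
  then show "adj (k * w) * (k * w)
      = adj w * w - adj w * f * w + complex_of_real (a * a) *\<^sub>C (adj w * f * w)"
    by (simp add: algebra_simps)
qed

lemma conjugate_pair_scale:
  assumes "conjugate_pair N M \<alpha> \<alpha>' u u'" "r * r' = (1::real)"
  shows "conjugate_pair N M \<alpha> \<alpha>' (complex_of_real r *\<^sub>C u) (complex_of_real r' *\<^sub>C u')"
proof -
  have "complex_of_real r * complex_of_real r' = 1"
    unfolding of_real_mult[symmetric] assms(2) by simp
  then show ?thesis using assms(1) by (auto simp: conjugate_pair_def Hom_def mult.commute)
qed

end

text \<open>The linear term must vanish. The constant \<open>c\<close> is chosen to exceed both
  coefficients, so the test value h = - D / c is admissible and the quadratic term cannot
  compensate.\<close>

lemma balance_inequality:
  fixes A B d :: real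
  assumes "0 < d" and *: "\<And>h. \<bar>h\<bar> < 1 \<Longrightarrow> 0 \<le> d * h * (A - B) + h\<^sup>2 * (d * A - A * B)"
  shows "A = B"
proof (rule ccontr)
  assume "A \<noteq> B"
  define D where "D = d * (A - B)"
  define E where "E = d * A - A * B"
  have D: "D \<noteq> 0" using \<open>A \<noteq> B\<close> assms by (simp add: D_def)
  define c where "c = \<bar>E\<bar> + \<bar>D\<bar> + 1"
  have c: "0 < c" "\<bar>E\<bar> < c" "\<bar>D\<bar> < c" using D by (auto simp: c_def)
  have "\<bar>- D / c\<bar> < 1" using c by simp
  from *[OF this] have "0 \<le> (- D / c) * D + (- D / c)\<^sup>2 * E"
    by (simp add: D_def E_def mult_ac)
  also have "\<dots> = D\<^sup>2 / c * (E / c - 1)" using c by (simp add: field_simps power2_eq_square)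
  finally have "0 \<le> E / c - 1" using D c by (simp add: zero_le_mult_iff zero_le_divide_iff)
  then show False using c by (simp add: field_simps abs_less_iff)
qed

context conjugate_projections
begin

text \<open>Among the perturbed pairs the original one is extremal.\<close>

lemma minimal_balanced:
  assumes d: "adj w * w = complex_of_real d *\<^sub>C 1" "adj w' * w' = complex_of_real d *\<^sub>C 1" "0 < d"
    and minimal: "\<And>D. D \<in> dim_values N M \<alpha> \<Longrightarrow> d \<le> D"
    and A: "adj w * f * w = complex_of_real A *\<^sub>C 1" and B: "adj w' * e * w' = complex_of_real B *\<^sub>C 1"
  shows "A = B"
proof -
  interpret dual: conjugate_projections M N \<alpha>' \<alpha> w' w f e by (rule dual_projections)
  \<comment> \<open>A and d - A are the squared moduli of \<open>f * w\<close> and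
    \<open>(1 - f) * w\<close>, and similarly for B.\<close>
  have nonneg: "0 \<le> A \<and> A \<le> d" "0 \<le> B \<and> B \<le> d"
  proof -
    have pos: "0 \<le> r" if "adj a * a = complex_of_real r *\<^sub>C 1" "(1::'c bop) \<noteq> 0"
      for a :: "'c::chilbert_space bop" and r
      using adj_mult_self_scalar[OF that] by simp
    have "adj (f * w) * (f * w) = complex_of_real A *\<^sub>C 1"
      "adj ((1 - f) * w) * ((1 - f) * w) = complex_of_real (d - A) *\<^sub>C 1"
      "adj (e * w') * (e * w') = complex_of_real B *\<^sub>C 1"
      "adj ((1 - e) * w') * ((1 - e) * w') = complex_of_real (d - B) *\<^sub>C 1"
      using A B d by (simp_all add: mult.assoc algebra_simps bop_scaleC_linear)
    then show "0 \<le> A \<and> A \<le> d" "0 \<le> B \<and> B \<le> d"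
      using pos factor_nonzero[OF facN] factor_nonzero[OF facM] by fastforce+
  qed
  have "0 \<le> d * h * (A - B) + h\<^sup>2 * (d * A - A * B)" if h: "\<bar>h\<bar> < 1" for h :: real
  proof -
    \<comment> \<open>The perturbation weights the \<open>f\<close>-part of one modulus by b and the
      \<open>e\<close>-part of the other by 1 / b; taking the square root a of b makes b the free
      parameter.\<close>
    define b where "b = 1 + h"
    have b: "0 < b" using h by (simp add: b_def)
    define a where "a = sqrt b"
    have a: "a * (1 / a) = 1" "a * a = b" "1 / a * (1 / a) = 1 / b" "1 / a * a = 1"
      using b by (simp_all add: a_def)
    define W where "W = (1 - f + complex_of_real a *\<^sub>C f) * w"
    define W' where "W' = (1 - e + complex_of_real (1 / a) *\<^sub>C e) * w'"
    define n where "n = d - A + b * A"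
    define n' where "n' = d - B + B / b"
    have n: "adj W * W = complex_of_real n *\<^sub>C 1"
      using perturbed_pair(2)[OF a(1)] d A unfolding W_def a n_def
      by (simp add: bop_scaleC_linear)
    have n': "adj W' * W' = complex_of_real n' *\<^sub>C 1"
      using dual.perturbed_pair(2)[OF a(4)] d B unfolding W'_def a n'_def
      by (simp add: bop_scaleC_linear)
    have WW: "conjugate_pair N M \<alpha> \<alpha>' W W'"
      unfolding W_def W'_def by (rule perturbed_pair(1)[OF a(1)])
    have npos: "0 < n" "0 < n'"
    proof -
      have "0 < (d - A) + b * A" if "A \<noteq> 0" using that nonneg b by (simp add: add_nonneg_pos)
      then show "0 < n" using d(3) by (cases "A = 0") (auto simp: n_def)
      have "0 < (d - B) + B / b" if "B \<noteq> 0" using that nonneg b by (simp add: add_nonneg_pos)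
      then show "0 < n'" using d(3) by (cases "B = 0") (auto simp: n'_def)
    qed
    \<comment> \<open>Elements of \<open>dim_values\<close> need the same scalar on both sides.
      Rescaling by r and 1 / r turns n and n' into their geometric mean.\<close>
    define r where "r = sqrt (sqrt (n' / n))"
    have r: "r * (1 / r) = 1" "r * r = sqrt (n' / n)" using npos by (simp_all add: r_def)
    have rn: "r * r * n = sqrt (n * n')" "1 / r * (1 / r) * n' = sqrt (n * n')"
    proof -
      have s: "sqrt n * sqrt n = n" "sqrt n' * sqrt n' = n'" "0 < sqrt n" "0 < sqrt n'"
        using npos by auto
      have "1 / r * (1 / r) = sqrt n / sqrt n'"
        using r(2) by (simp add: real_sqrt_divide)
      then show "1 / r * (1 / r) * n' = sqrt (n * n')"
        using s by (simp only: real_sqrt_mult) (simp add: field_simps)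
      show "r * r * n = sqrt (n * n')"
        unfolding r(2) using s by (simp add: real_sqrt_mult real_sqrt_divide field_simps)
    qed
    have sq: "adj (complex_of_real r *\<^sub>C u) * (complex_of_real r *\<^sub>C u)
        = complex_of_real (r * r * n) *\<^sub>C 1"
      if "adj u * u = complex_of_real n *\<^sub>C 1" for u :: "'c::chilbert_space bop" and r n
      using that by (simp add: mult_ac)
    have "sqrt (n * n') \<in> dim_values N M \<alpha>"
      unfolding dim_values_def mem_Collect_eq
      using conjugate_pair_scale[OF WW r(1)] sq[OF n, of r, unfolded rn]
        sq[OF n', of "1 / r", unfolded rn] by blast
    then have "d \<le> sqrt (n * n')" by (rule minimal)
    then have "d\<^sup>2 \<le> n * n'"
      using d(3) npos by (metis less_imp_le mult_pos_pos real_le_rsqrt real_sqrt_le_iff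
          real_sqrt_abs abs_of_pos order.trans)
    then have "d\<^sup>2 * b \<le> n * (n' * b)" using b by simp
    \<comment> \<open>Clearing the denominator b makes the inequality polynomial in h, with linear
      coefficient d * (A - B).\<close>
    also have "n' * b = d * b - B * b + B" using b by (simp add: n'_def field_simps)
    finally show ?thesis by (simp add: n_def b_def algebra_simps power2_eq_square)
  qed
  from balance_inequality[OF d(3) this] show ?thesis .
qed

end

section \<open>Restricting a conjugate pair to the range of a projection, and replacing that
  part\<close>

locale reduced_pair = conjugate_projections N M \<alpha> \<alpha>' w w' e f
  for N :: "'h::chilbert_space bop set" and M :: "'k::chilbert_space bop set"
    and \<alpha> \<alpha>' w w' e f +
  fixes s :: "'k bop" and t :: "'h bop"
  assumes s: "s \<in> M" "is_isometry s" "s * adj s = e"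
    and t: "t \<in> N" "is_isometry t" "t * adj t = f"
begin

lemma dual_reduced: "reduced_pair M N \<alpha>' \<alpha> w' w f e t s"
  using dual_projections s t by (auto simp: reduced_pair_def reduced_pair_axioms_def)

lemma st_closed [simp]: "s \<in> M" "t \<in> N"
  using s t by auto

lemma st_simps [simp]:
  "adj s * s = 1" "adj t * t = 1" "s * adj s = e" "t * adj t = f"
  "e * s = s" "f * t = t" "adj s * e = adj s" "adj t * f = adj t"
proof -
  show 1: "adj s * s = 1" "adj t * t = 1" and 2: "s * adj s = e" "t * adj t = f"
    using s t by (auto simp: is_isometry_def)
  show 3: "e * s = s" "f * t = t"
    unfolding 2[symmetric] by (simp_all add: mult.assoc 1)
  show "adj s * e = adj s" "adj t * f = adj t"
    using arg_cong[OF 3(1), of adj] arg_cong[OF 3(2), of adj] by auto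
qed

lemmas st_cont [simp] = st_simps[THEN mult_cont, simplified]

lemma image_ss: "\<alpha>' s * adj (\<alpha>' s) = \<alpha>' e" "\<alpha> t * adj (\<alpha> t) = \<alpha> f"
  "adj (\<alpha>' s) * \<alpha>' s = 1" "adj (\<alpha> t) * \<alpha> t = 1"
  using hom_simps(10)[of s "adj s"] hom_simps(4)[of t "adj t"]
    hom_simps(10)[of "adj s" s] hom_simps(4)[of "adj t" t] by auto

lemma star_hom_e: "star_hom N M (\<lambda>n. adj s * \<alpha> n * s)"
  by (rule star_hom_reduced[OF hom N.vn_algebra_axioms M.vn_algebra_axioms e(1) s])

lemma star_hom_f: "star_hom M N (\<lambda>m. adj t * \<alpha>' m * t)"
  by (rule star_hom_reduced[OF hom' M.vn_algebra_axioms N.vn_algebra_axioms f(1) t])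

lemmas f_left = f_right[symmetric] f_right[symmetric, THEN mult_cont]

lemma reduced_Hom:
  "adj t * \<alpha>' (adj s) * w \<in> Hom N N id ((\<lambda>m. adj t * \<alpha>' m * t) \<circ> (\<lambda>n. adj s * \<alpha> n * s))"
  by (auto simp: Hom_def mult.assoc w_rules f_left image_ss image_ss[THEN mult_cont] fw)

lemma reduced_conj:
  "adj (adj t * \<alpha>' (adj s) * w) * (adj t * \<alpha>' (adj s * \<alpha> (adj t) * w') * t) = 1"
  by (simp add: mult.assoc w_rules f_right f_right[THEN mult_cont] image_ss
      image_ss[THEN mult_cont] adj_fw[THEN mult_cont])

text \<open>Cutting both legs costs no more than cutting one: \<open>\<alpha>' e\<close> next to
  \<open>w\<close> turns into \<open>f\<close>, which is already there.\<close>

lemma reduced_norm: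
  "adj (adj t * \<alpha>' (adj s) * w) * (adj t * \<alpha>' (adj s) * w) = adj w * f * w"
  by (simp add: mult.assoc f_right f_right[THEN mult_cont] image_ss
      image_ss[THEN mult_cont] adj_fw[THEN mult_cont])

lemma reduced_conjugate_pair:
  "conjugate_pair N M (\<lambda>n. adj s * \<alpha> n * s) (\<lambda>m. adj t * \<alpha>' m * t)
     (adj t * \<alpha>' (adj s) * w) (adj s * \<alpha> (adj t) * w')"
proof -
  interpret dual: reduced_pair M N \<alpha>' \<alpha> w' w f e t s by (rule dual_reduced)
  have "adj (adj (adj s * \<alpha> (adj t) * w') * (adj s * \<alpha> (adj t * \<alpha>' (adj s) * w) * s)) = 1"
    using dual.reduced_conj by simp
  then have "adj s * \<alpha> (adj (adj t * \<alpha>' (adj s) * w)) * s * (adj s * \<alpha> (adj t) * w') = 1"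
    by (simp add: mult.assoc)
  then show ?thesis
    unfolding conjugate_pair_def
    using star_hom_e star_hom_f reduced_Hom dual.reduced_Hom reduced_conj by simp
qed

text \<open>The part of the old pair over \<open>e\<close> is cut out and an arbitrary pair for the
  range of \<open>e\<close> is glued in. The new conjugate \<delta> is \<gamma> transported along
  \<open>t\<close> plus what \<open>1 - f\<close> leaves of \<open>\<alpha>'\<close>. Orthogonality
  kills the cross terms, so the squared moduli simply add.\<close>

lemma replaced_pair:
  assumes red: "conjugate_pair N M (\<lambda>n. adj s * \<alpha> n * s) \<gamma> u u'"
  shows "\<exists>\<delta> W W'. conjugate_pair N M \<alpha> \<delta> W W' \<and>
    adj W * W = adj u * u + adj w * (1 - f) * w \<and>
    adj W' * W' = adj u' * u' + adj w' * (1 - e) * w'"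
proof -
  define g where "g = 1 - f"
  define h where "h = 1 - e"
  interpret c: conjugate_projections N M \<alpha> \<alpha>' w w' h g unfolding g_def h_def by (rule complement)
  have fg: "f + g = 1" and eh: "e + h = 1" by (simp_all add: g_def h_def)
  have gt: "g * t = 0" "adj t * g = 0" "h * s = 0" "adj s * h = 0"
    by (simp_all add: g_def h_def left_diff_distrib right_diff_distrib)
  have gamma: "star_hom M N \<gamma>" using red by (simp add: conjugate_pair_def)
  note gs [simp] = star_homD[OF gamma] star_hom_zero[OF gamma M.vn_algebra_axioms]
  have u [simp]: "u \<in> N" "u' \<in> M" using red by (auto simp: conjugate_pair_def Hom_def)
  have um: "u * n = adj (\<gamma> s) * (\<gamma> (\<alpha> n) * (\<gamma> s * u))" if "n \<in> N" for n
    using red that by (simp add: conjugate_pair_def Hom_def mult.assoc)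
  have um': "u' * m = adj s * (\<alpha> (\<gamma> m) * (s * u'))" if "m \<in> M" for m
    using red that by (simp add: conjugate_pair_def Hom_def mult.assoc)
  have uu: "adj u * \<gamma> u' = 1" "adj s * (adj (\<alpha> u) * (s * u')) = 1"
    using red by (simp_all add: conjugate_pair_def mult.assoc)
  have gss: "adj (\<gamma> s) * \<gamma> s = 1" "\<gamma> s * adj (\<gamma> s) = \<gamma> e"
    using gs(4)[of "adj s" s] gs(4)[of s "adj s"] by simp_all
  have ges: "\<gamma> e * \<gamma> s = \<gamma> s" "adj (\<gamma> s) * \<gamma> e = adj (\<gamma> s)" "adj (\<gamma> s) * \<gamma> h = 0"
    using gs(4)[of e s] gs(4)[of "adj s" e] gs(4)[of "adj s" h] by (simp_all add: gt)
  have ge: "\<gamma> e * \<gamma> (\<alpha> n) = \<gamma> (\<alpha> n) * \<gamma> e" if "n \<in> N" for n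
    using gs(4)[of e "\<alpha> n"] gs(4)[of "\<alpha> n" e] e_right(1)[of n] that by simp
  define \<delta> where "\<delta> m = t * \<gamma> m * adj t + g * \<alpha>' m" for m
  define W where "W = t * (\<gamma> s * u) + g * w"
  define W' where "W' = \<alpha> t * (s * u') + h * w'"
  note z = gt gt[THEN mult_cont]
  have ag: "\<alpha> g * \<alpha> t = 0" "adj (\<alpha> t) * \<alpha> g = 0"
    using hom_simps(4)[of g t] hom_simps(4)[of "adj t" g] by (simp_all add: z)
  have agg: "\<alpha> g * \<alpha> g = \<alpha> g" using hom_simps(4)[of g g] by simp
  have ga: "\<alpha> g * \<alpha> (\<alpha>' m) = \<alpha> (\<alpha>' m) * \<alpha> g" if "m \<in> M" for m
    using hom_simps(4)[of g "\<alpha>' m"] hom_simps(4)[of "\<alpha>' m" g] c.f_right(1)[of m] that by simp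
  have W: "adj W = adj u * (adj (\<gamma> s) * adj t) + adj w * g" by (simp add: W_def mult.assoc)
  have W': "adj W' = adj u' * (adj s * adj (\<alpha> t)) + adj w' * h" by (simp add: W'_def mult.assoc)
  have mem [simp]: "W \<in> N" "W' \<in> M" by (simp_all add: W_def W'_def)
  have tg: "adj t * (\<alpha>' m * g) = 0" if "m \<in> M" for m
    using that by (simp add: z flip: c.f_right)
  have \<delta>: "star_hom M N \<delta>"
    unfolding star_hom_def \<delta>_def
    by (auto simp: fg algebra_simps bop_scaleC_linear z tg c.f_right c.f_right[THEN mult_cont])
  have Wn: "W * n = \<delta> (\<alpha> n) * W" if "n \<in> N" for n
    unfolding W_def \<delta>_def using that
    by (simp add: algebra_simps um um[THEN mult_cont] gss gss[THEN mult_cont] ge ge[THEN mult_cont]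
        ges ges[THEN mult_cont] z c.f_right c.f_right[THEN mult_cont] w_rules)
  have Wm: "W' * m = \<alpha> (\<delta> m) * W'" if "m \<in> M" for m
    unfolding W'_def \<delta>_def using that
    by (simp add: distrib_left distrib_right mult.assoc um' um'[THEN mult_cont] image_ss(3,4)
        image_ss(3,4)[THEN mult_cont] e_right e_right[THEN mult_cont] c.e_right c.e_right[THEN mult_cont]
        w_rules c.ew[symmetric] ag ag[THEN mult_cont] ga ga[THEN mult_cont] agg
        agg[THEN mult_cont])
  have c1: "adj W * \<delta> W' = 1"
  proof -
    have u1: "adj u * (adj (\<gamma> s) * (\<gamma> (\<alpha> n) * \<gamma> s)) = n * adj u" if "n \<in> N" for n
      using arg_cong[OF um[of "adj n"], of adj] that by (simp add: mult.assoc)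
    have 1: "adj u * (adj (\<gamma> s) * \<gamma> W') = t * (adj u * \<gamma> u')"
      by (simp add: W'_def distrib_left distrib_right ges[THEN mult_cont] flip: u1 mult.assoc)
        (simp add: mult.assoc ges ges[THEN mult_cont])
    \<comment> \<open>Slid around \<open>w\<close>, the complement \<open>g\<close> becomes
      \<open>h\<close>, which annihilates the \<open>s\<close>-part of \<open>W'\<close> and fixes
      the other one.\<close>
    have wg: "adj w * (g * \<alpha>' m) = adj w * \<alpha>' (h * m)" if "m \<in> M" for m
    proof -
      have "adj w * (g * \<alpha>' m) = adj w * \<alpha>' h * \<alpha>' m" by (simp only: c.adj_fw mult.assoc)
      then show ?thesis using that by (simp add: mult.assoc)
    qed
    have 2: "adj w * (g * \<alpha>' (\<alpha> t * (s * u'))) = 0"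
    proof -
      have "adj w * (g * \<alpha>' (\<alpha> t * (s * u'))) = adj w * \<alpha>' (h * (\<alpha> t * (s * u')))"
        by (rule wg) simp
      also have "h * (\<alpha> t * (s * u')) = 0"
        by (simp add: c.e_right(1)[THEN mult_cont] mult.assoc gt(3)[THEN mult_cont])
      finally show ?thesis by simp
    qed
    have 3: "adj w * (g * \<alpha>' (h * w')) = g"
    proof -
      have "adj w * (g * \<alpha>' (h * w')) = adj w * \<alpha>' (h * (h * w'))"
        by (rule wg) simp
      also have "\<dots> = adj w * \<alpha>' h * \<alpha>' w'" by (simp add: mult.assoc)
      also have "\<dots> = g" by (simp add: c.adj_fw mult.assoc c.f_right w_rules)
      finally show ?thesis .
    qed
    have "adj W * \<delta> W' = t * (adj u * \<gamma> u') * adj t + adj w * (g * \<alpha>' W')"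
      unfolding W \<delta>_def 1[symmetric] by (simp add: distrib_left distrib_right mult.assoc z)
    also have "adj w * (g * \<alpha>' W') = g"
      using 2 3 unfolding W'_def by (simp add: distrib_left)
    finally show ?thesis by (simp add: uu fg)
  qed
  have c2: "\<alpha> (adj W) * W' = 1"
  proof -
    have "e * (adj (\<alpha> u) * (s * u')) = s" using uu(2) by (metis mult.assoc mult_1_right s(3))
    then have u2: "adj (\<alpha> u) * (s * u') = s" by (simp add: e_right[THEN mult_cont] mult.assoc)
    have u3: "adj (\<alpha> (\<gamma> s)) * (s * u') = s * (u' * adj s)"
      by (simp add: um' e_right[THEN mult_cont] mult.assoc)
    have "\<alpha> (adj W) = adj (\<alpha> u) * (adj (\<alpha> (\<gamma> s)) * adj (\<alpha> t)) + adj (\<alpha> w) * \<alpha> g"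
      by (simp add: W)
    then have "\<alpha> (adj W) * W' = adj (\<alpha> u) * (adj (\<alpha> (\<gamma> s)) * (s * u')) + adj (\<alpha> w) * (\<alpha> g * w')"
      by (simp add: W'_def distrib_left distrib_right mult.assoc image_ss(4)[THEN mult_cont]
          c.ew[symmetric] ag ag[THEN mult_cont] agg agg[THEN mult_cont])
    also have "\<dots> = adj (\<alpha> u) * (s * u') * adj s + h * (adj (\<alpha> w) * w')"
      by (simp add: u3 c.ew c.e_right[THEN mult_cont] mult.assoc)
    finally show ?thesis by (simp add: u2 conj_eq eh)
  qed
  have n1: "adj W * W = adj u * u + adj w * g * w"
    unfolding W unfolding W_def
    by (simp add: distrib_left distrib_right mult.assoc z gss gss[THEN mult_cont])
  have n2: "adj W' * W' = adj u' * u' + adj w' * h * w'"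
  proof -
    have x: "adj (\<alpha> t) * (h * w') = 0" by (simp add: c.ew[symmetric] ag[THEN mult_cont])
    have "adj (adj (\<alpha> t) * (h * w')) = 0" by (simp only: x adj_zero)
    then have y: "adj w' * (h * \<alpha> t) = 0" by (simp add: mult.assoc)
    show ?thesis
      unfolding W' unfolding W'_def
      by (simp add: distrib_left distrib_right mult.assoc x image_ss(4)[THEN mult_cont]
          y[unfolded mult.assoc[symmetric], THEN mult_cont, unfolded mult.assoc])
  qed
  have "conjugate_pair N M \<alpha> \<delta> W W'"
    unfolding conjugate_pair_def using hom \<delta> c1 c2 Wn Wm by (auto simp: Hom_def)
  with n1 n2 show ?thesis unfolding g_def h_def by blast
qed

lemma reduced_standard:
  assumes d: "adj w * w = complex_of_real d *\<^sub>C 1" "adj w' * w' = complex_of_real d *\<^sub>C 1"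
    and minimal: "\<And>D. D \<in> dim_values N M \<alpha> \<Longrightarrow> d \<le> D"
    and c: "adj w * f * w = complex_of_real c *\<^sub>C 1" "adj w' * e * w' = complex_of_real c *\<^sub>C 1"
    and \<beta>: "\<And>n. n \<in> N \<Longrightarrow> \<beta> n = adj s * \<alpha> n * s"
  shows "finite_dim N M \<beta>" "hom_dim N M \<beta> = c"
    "standard_pair N M \<beta> (\<lambda>m. adj t * \<alpha>' m * t) (adj t * \<alpha>' (adj s) * w) (adj s * \<alpha> (adj t) * w')"
proof -
  interpret dual: reduced_pair M N \<alpha>' \<alpha> w' w f e t s by (rule dual_reduced)
  have pair: "conjugate_pair N M \<beta> (\<lambda>m. adj t * \<alpha>' m * t)
     (adj t * \<alpha>' (adj s) * w) (adj s * \<alpha> (adj t) * w')"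
    using conjugate_pair_cong[OF N.vn_algebra_axioms, of \<beta> "\<lambda>n. adj s * \<alpha> n * s"] \<beta>
      reduced_conjugate_pair by auto
  have cin: "c \<in> dim_values N M \<beta>"
    unfolding dim_values_def mem_Collect_eq
    using pair reduced_norm[unfolded c] dual.reduced_norm[unfolded c] by blast
  have "c \<le> D" if D: "D \<in> dim_values N M \<beta>" for D
  proof -
    have "D \<in> dim_values N M (\<lambda>n. adj s * \<alpha> n * s)"
      using D dim_values_cong[OF N.vn_algebra_axioms, of \<beta> "\<lambda>n. adj s * \<alpha> n * s"] \<beta> by auto
    then obtain \<gamma> u u' where red: "conjugate_pair N M (\<lambda>n. adj s * \<alpha> n * s) \<gamma> u u'"
      and u: "adj u * u = complex_of_real D *\<^sub>C 1" "adj u' * u' = complex_of_real D *\<^sub>C 1"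
      unfolding dim_values_def by blast
    obtain \<delta> W W' where "conjugate_pair N M \<alpha> \<delta> W W'"
      and "adj W * W = adj u * u + adj w * (1 - f) * w"
      and "adj W' * W' = adj u' * u' + adj w' * (1 - e) * w'"
      using replaced_pair[OF red] by blast
    \<comment> \<open>The untouched complement contributes d - c on both sides alike; therefore the
      completed pair again has one common value.\<close>
    moreover have "adj w * (1 - f) * w = complex_of_real (d - c) *\<^sub>C 1"
      "adj w' * (1 - e) * w' = complex_of_real (d - c) *\<^sub>C 1"
      using c d by (simp_all add: left_diff_distrib right_diff_distrib bop_scaleC_linear)
    ultimately have "D + (d - c) \<in> dim_values N M \<alpha>"
      unfolding dim_values_def mem_Collect_eq
      using u by (metis bop_scaleC_linear(1) of_real_add)
    from minimal[OF this] show ?thesis by simp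
  qed
  then show "hom_dim N M \<beta> = c"
    unfolding hom_dim_def using cin by (intro cInf_eq_minimum) auto
  with pair show "standard_pair N M \<beta> (\<lambda>m. adj t * \<alpha>' m * t)
     (adj t * \<alpha>' (adj s) * w) (adj s * \<alpha> (adj t) * w')"
    unfolding standard_pair_def reduced_norm dual.reduced_norm c by blast
  show "finite_dim N M \<beta>" using cin by (auto simp: finite_dim_def)
qed

end

section \<open>Conjugates of projections and the reduced Q-system\<close>

context conjugate_factors
begin

text \<open>The conjugate equation recovers \<open>a\<close> from
  \<open>adj w * \<alpha>' a\<close>. Identities in \<open>M\<close> can thus be tested in
  \<open>N\<close> after contraction with \<open>w\<close>.\<close>

lemma \<alpha>'_zero:
  assumes "a \<in> M" "adj w * \<alpha>' a = 0"
  shows "a = 0"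
proof -
  have "a = adj (\<alpha> w) * (w' * a)" by (simp add: w_rules)
  also have "\<dots> = \<alpha> (adj w * \<alpha>' a) * w'" using assms(1) by (simp add: w_move mult.assoc)
  finally show ?thesis by (simp add: assms(2))
qed

lemma \<alpha>'_inj: "a \<in> M \<Longrightarrow> b \<in> M \<Longrightarrow> \<alpha>' a = \<alpha>' b \<Longrightarrow> a = b"
  using \<alpha>'_zero[of "a - b"] by simp

text \<open>Here \<open>f\<close> is the rotation of \<open>e\<close>. Sliding holds around
  \<open>w'\<close> and around \<open>adj w\<close>; to slide around \<open>w\<close> itself, the
  last relation must be adjoined, which is harmless only if \<open>e\<close> and \<open>f\<close>
  are self-adjoint.\<close>

lemma conjugate_Hom:
  assumes e: "e \<in> Hom N M \<alpha> \<alpha>"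
  defines "f \<equiv> adj w * \<alpha>' e * \<alpha>' w'"
  shows "f \<in> Hom M N \<alpha>' \<alpha>'" "\<alpha> f * w' = e * w'" "adj w * f = adj w * \<alpha>' e"
proof -
  note [simp] = HomD(1)[OF e]
  note er = Hom_move[OF e] Hom_move[OF e, THEN mult_cont]
  have Em: "\<alpha>' e * \<alpha>' (\<alpha> n) = \<alpha>' (\<alpha> n) * \<alpha>' e" if "n \<in> N" for n
    using that hom_simps(10)[of e "\<alpha> n"] hom_simps(10)[of "\<alpha> n" e] er(1)[of n] by simp
  have wm: "\<alpha>' w' * \<alpha>' m = \<alpha>' (\<alpha> (\<alpha>' m)) * \<alpha>' w'" if "m \<in> M" for m
    using that hom_simps(10)[of w' m] by (simp add: w_move)
  show "f \<in> Hom M N \<alpha>' \<alpha>'"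
    by (auto simp: f_def Hom_def mult.assoc wm Em Em[THEN mult_cont] w_rules)
  have "\<alpha> f * w' = adj (\<alpha> w) * (w' * (e * w'))"
    by (simp add: f_def mult.assoc w_move(2)[symmetric] w_move(2)[symmetric, THEN mult_cont])
  then show "\<alpha> f * w' = e * w'" by (simp add: conj_eq(2)[THEN mult_cont])
  have "adj f * w = adj (\<alpha>' w') * (adj (\<alpha>' e) * \<alpha>' (\<alpha> w)) * w"
    by (simp add: f_def mult.assoc w_move)
  also have "adj (\<alpha>' e) * \<alpha>' (\<alpha> w) = \<alpha>' (\<alpha> w) * adj (\<alpha>' e)"
    using arg_cong[OF Em[of "adj w"], of adj] by simp
  also have "adj (\<alpha>' w') * \<dots> * w = \<alpha>' (adj w' * \<alpha> w) * (adj (\<alpha>' e) * w)"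
    by (simp add: mult.assoc)
  finally have "adj f * w = adj (\<alpha>' e) * w" by (simp add: w_rules)
  from arg_cong[OF this, of adj] show "adj w * f = adj w * \<alpha>' e" by simp
qed

text \<open>Idempotence passes from \<open>e\<close> to its rotation by sliding one factor at a
  time. Self-adjointness is demanded separately, since the adjoint of \<open>f\<close> is the
  opposite rotation.\<close>

lemma conjugate_projectionsI:
  assumes e: "e \<in> Hom N M \<alpha> \<alpha>" "is_proj e"
    and f: "f = adj w * \<alpha>' e * \<alpha>' w'" "adj f = f"
  shows "conjugate_projections N M \<alpha> \<alpha>' w w' e f"
proof -
  interpret dual: conjugate_factors M N \<alpha>' \<alpha> w' w by (rule dual)
  note c = conjugate_Hom[OF e(1), folded f(1)]
  note [simp] = HomD(1)[OF e(1)] is_projD[OF e(2)]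
  have "f * f = adj w * \<alpha>' (e * w') * f" by (subst (1) f(1)) (simp add: mult.assoc)
  also have "\<dots> = adj w * f * \<alpha>' (e * w')"
    using dual.Hom_move(1)[OF c(1), of "e * w'"] by (simp add: mult.assoc)
  also have "\<dots> = adj w * \<alpha>' (e * (e * w'))" by (simp add: c(3) mult.assoc)
  also have "\<dots> = f" by (simp add: f(1) mult.assoc mult_cont[OF is_projD(1)[OF e(2)]])
  finally have "is_proj f" using f(2) by (simp add: is_proj_def)
  moreover have "\<alpha>' e * w = f * w"
    using arg_cong[OF c(3), of adj] f(2) dual.hom_simps(6)[of e] by simp
  ultimately show ?thesis
    using e c by unfold_locales auto
qed

end

section \<open>The corner of a Q-system cut out on both legs\<close>

locale reduced_Q = conjugate_projections N M \<alpha> \<alpha>' w w' e f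
  for N :: "'h::chilbert_space bop set" and M :: "'k::chilbert_space bop set"
    and \<alpha> \<alpha>' w w' e f +
  fixes S :: "'h bop"
  assumes S: "S \<in> N" "is_isometry S" "S * adj S = f * \<alpha>' e"
begin

abbreviation "\<theta> n \<equiv> \<alpha>' (\<alpha> n)"
abbreviation "X \<equiv> \<alpha>' w'"
abbreviation "E \<equiv> \<alpha>' e"

lemma S_closed [simp]: "S \<in> N" by (rule S)

lemma E_simps [simp]: "E * E = E" "adj E = E" "\<theta> f * \<theta> f = \<theta> f"
  using hom_simps(10)[of e e] adj_images by (simp_all flip: hom_simps(4,10))

lemma fE: "f * E = E * f"
  by (simp add: f_right)

lemma S_simps [simp]: "adj S * S = 1" "f * S = S" "E * S = S" "adj S * f = adj S" "adj S * E = adj S"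
proof -
  show 1: "adj S * S = 1" using S by (simp add: is_isometry_def)
  have "S = f * E * S" unfolding S(3)[symmetric] by (simp add: mult.assoc 1)
  then show 2: "f * S = S" "E * S = S"
    by (metis ef_proj(3) mult.assoc) (metis E_simps(1) \<open>S = f * E * S\<close> fE mult.assoc)
  show "adj S * f = adj S" "adj S * E = adj S"
    using arg_cong[OF 2(1), of adj] arg_cong[OF 2(2), of adj] by auto
qed

lemma E_right: "n \<in> N \<Longrightarrow> E * \<theta> n = \<theta> n * E" "n \<in> N \<Longrightarrow> E * adj (\<theta> n) = adj (\<theta> n) * E"
proof -
  show *: "n \<in> N \<Longrightarrow> E * \<theta> n = \<theta> n * E" for n
    using hom_simps(10)[of e "\<alpha> n"] hom_simps(10)[of "\<alpha> n" e] e_right(1)[of n] by simp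
  show "n \<in> N \<Longrightarrow> E * adj (\<theta> n) = adj (\<theta> n) * E" using *[of "adj n"] by simp
qed

lemma X_move: "m \<in> M \<Longrightarrow> X * \<alpha>' m = \<theta> (\<alpha>' m) * X" "m \<in> M \<Longrightarrow> X * adj (\<alpha>' m) = adj (\<theta> (\<alpha>' m)) * X"
proof -
  show *: "m \<in> M \<Longrightarrow> X * \<alpha>' m = \<theta> (\<alpha>' m) * X" for m
    using hom_simps(10)[of w' m] by (simp add: w_move)
  show "m \<in> M \<Longrightarrow> X * adj (\<alpha>' m) = adj (\<theta> (\<alpha>' m)) * X" using *[of "adj m"] by simp
qed

lemma fX: "\<theta> f * X = E * X"
  using hom_simps(10)[of "\<alpha> f" w'] hom_simps(10)[of e w'] ew by simp

lemma EX: "\<theta> E * X = X * E"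
  by (simp add: X_move)

lemma SS_simps:
  "S * adj S = f * E" "\<theta> S * adj (\<theta> S) = \<theta> f * \<theta> E"
  "adj (\<theta> S) * \<theta> f = adj (\<theta> S)" "adj (\<theta> S) * \<theta> E = adj (\<theta> S)"
proof -
  show "S * adj S = f * E" by (rule S)
  show "\<theta> S * adj (\<theta> S) = \<theta> f * \<theta> E"
    using arg_cong[OF S(3), of \<theta>] by simp
  show "adj (\<theta> S) * \<theta> f = adj (\<theta> S)" "adj (\<theta> S) * \<theta> E = adj (\<theta> S)"
    using arg_cong[OF S_simps(4), of \<theta>] arg_cong[OF S_simps(5), of \<theta>]
    by (simp_all del: S_simps)
qed

text \<open>An \<open>E\<close> on either side of \<open>X\<close> can be written as
  \<open>\<theta> E\<close> or \<open>\<theta> f\<close> in front of \<open>X\<close>, where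
  \<open>adj (\<theta> S)\<close> absorbs it. Projections created on the middle strands therefore
  disappear.\<close>

lemma S_absorb: "adj (\<theta> S) * (X * E) = adj (\<theta> S) * X" "adj (\<theta> S) * (E * X) = adj (\<theta> S) * X"
  by (simp_all flip: EX fX add: SS_simps SS_simps[THEN mult_cont])

text \<open>Oriented rules: \<open>f\<close> and \<open>E\<close> travel left past values of
  \<open>\<alpha>'\<close> and \<theta> until an adjoint isometry absorbs them.\<close>

lemmas left_rules = mult.assoc f_right[symmetric] f_right[symmetric, THEN mult_cont]
  E_right[symmetric] E_right[symmetric, THEN mult_cont] fX fX[THEN mult_cont] EX EX[THEN mult_cont]
  S_simps[THEN mult_cont] E_simps(1,3)[THEN mult_cont] SS_simps SS_simps[THEN mult_cont]
  S_absorb S_absorb[unfolded mult.assoc[symmetric], THEN mult_cont, unfolded mult.assoc]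

lemma X_conj: "adj w * X = 1" "adj (\<theta> w) * X = 1"
  using w_rules hom_simps(10)[of "adj (\<alpha> w)" w'] by simp_all

lemma X_frobenius: "adj (\<theta> X) * X = X * adj X"
  using hom_simps(10)[of "adj (\<alpha> (\<alpha>' w'))" w'] hom_simps(10)[of w' "adj w'"] by (simp add: w_move)

definition "\<theta>\<^sub>P n = adj S * \<theta> n * S"
definition "w\<^sub>P = adj S * w"
definition "x\<^sub>P = adj S * \<theta> (adj S) * X * S"

lemmas P_defs = \<theta>\<^sub>P_def w\<^sub>P_def x\<^sub>P_def

lemma P_closed [simp]: "w\<^sub>P \<in> N" "x\<^sub>P \<in> N" "n \<in> N \<Longrightarrow> \<theta>\<^sub>P n \<in> N"
  by (simp_all add: P_defs)

lemma w\<^sub>P_Hom: "w\<^sub>P \<in> Hom N N id \<theta>\<^sub>P"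
  unfolding Hom_def by (auto simp: P_defs left_rules fw w_rules)

lemma x\<^sub>P_Hom: "x\<^sub>P \<in> Hom N N \<theta>\<^sub>P (\<theta>\<^sub>P \<circ> \<theta>\<^sub>P)"
  unfolding Hom_def by (auto simp: P_defs left_rules X_move(1)[of "\<alpha> n" for n, THEN mult_cont])

text \<open>No \<open>adj S\<close> stands to the left of the projections produced by
  \<open>S * adj S\<close>, so they are moved right instead, against the orientation of
  \<open>left_rules\<close>.\<close>

lemma counit_left: "adj w\<^sub>P * x\<^sub>P = 1"
proof -
  have "adj w\<^sub>P * x\<^sub>P = adj w * (f * (E * (adj (\<theta> S) * (X * S))))"
    by (simp add: P_defs mult.assoc SS_simps SS_simps[THEN mult_cont])
  also have "\<dots> = adj w * (adj (\<theta> S) * (X * S))"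
    by (simp add: mult.assoc f_right f_right[THEN mult_cont] E_right E_right[THEN mult_cont]
        fX[symmetric] fX[symmetric, THEN mult_cont] SS_simps SS_simps[THEN mult_cont])
  also have "\<dots> = 1" by (simp add: mult.assoc w_rules X_conj[THEN mult_cont])
  finally show ?thesis .
qed

lemma counit_right: "\<theta>\<^sub>P (adj w\<^sub>P) * x\<^sub>P = 1"
  by (simp add: P_defs left_rules X_conj[THEN mult_cont])

lemma coassociative: "x\<^sub>P * x\<^sub>P = \<theta>\<^sub>P x\<^sub>P * x\<^sub>P"
  by (simp add: P_defs left_rules X_move(2)[of "\<alpha> S"] X_move(2)[of "\<alpha> S", THEN mult_cont]
      X_move(1)[of w'] X_move(1)[of w', THEN mult_cont])

lemma frobenius: "\<theta>\<^sub>P (adj x\<^sub>P) * x\<^sub>P = x\<^sub>P * adj x\<^sub>P"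
  by (simp add: P_defs left_rules X_move(1)[of "\<alpha> S", symmetric] X_move(1)[of "\<alpha> S", symmetric, THEN mult_cont]
      X_frobenius X_frobenius[THEN mult_cont])

context
  fixes c :: complex
  assumes c: "adj w * f * w = c *\<^sub>C 1" "adj w' * e * w' = c *\<^sub>C 1"
begin

lemma XEX: "adj X * (E * X) = c *\<^sub>C 1"
  using arg_cong[OF c(2), of \<alpha>'] by (simp add: mult.assoc)

lemma w\<^sub>P_norm: "adj w\<^sub>P * w\<^sub>P = c *\<^sub>C 1"
  using c(1) by (simp add: P_defs left_rules fw)

lemma x\<^sub>P_norm: "adj x\<^sub>P * x\<^sub>P = c *\<^sub>C 1"
  by (simp add: P_defs left_rules XEX XEX[unfolded mult.assoc[symmetric], THEN mult_cont, unfolded mult.assoc])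

lemma n\<^sub>P: "adj S * adj X * (f * E * \<theta> (f * E)) * X * S = c *\<^sub>C 1"
  by (simp add: left_rules XEX XEX[unfolded mult.assoc[symmetric], THEN mult_cont, unfolded mult.assoc])

text \<open>The projection \<open>f * E\<close> is its own conjugate with respect to the pair
  \<open>(X * w, X * w)\<close> of \<theta>: sliding around the nested cups exchanges its two legs.
  This lets the theory of reduced pairs be applied to \<theta> itself.\<close>

lemma self_conjugate: "\<theta> (f * E) * (X * w) = f * E * (X * w)"
  by (simp add: left_rules fw)

text \<open>The inner loop over \<open>E\<close> closes to c, then the outer loop over
  \<open>f\<close> closes to c.\<close>

lemma self_conjugate_norm: "adj (X * w) * (f * E) * (X * w) = (c * c) *\<^sub>C 1"
  using c(1) by (simp add: left_rules XEX XEX[unfolded mult.assoc[symmetric], THEN mult_cont, unfolded mult.assoc])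

lemma Q_system_P:
  assumes \<theta>': "\<And>n. n \<in> N \<Longrightarrow> \<theta>' n = \<theta>\<^sub>P n" "\<theta>' \<in> C" "star_hom N N \<theta>'"
    and d: "c = complex_of_real (sqrt (hom_dim N N \<theta>'))"
  shows "Q_system N C \<theta>' w\<^sub>P x\<^sub>P"
proof -
  note st = star_homD[OF \<theta>'(3)]
  have eqs: "\<theta>' (adj w\<^sub>P) * x\<^sub>P = 1" "x\<^sub>P * x\<^sub>P = \<theta>' x\<^sub>P * x\<^sub>P" "\<theta>' (adj x\<^sub>P) * x\<^sub>P = x\<^sub>P * adj x\<^sub>P"
    using counit_right coassociative frobenius by (simp_all add: \<theta>')
  have "adj (\<theta>' (adj x\<^sub>P) * x\<^sub>P) = adj (x\<^sub>P * adj x\<^sub>P)" by (simp only: eqs)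
  then have "x\<^sub>P * adj x\<^sub>P = adj x\<^sub>P * \<theta>' x\<^sub>P" by (simp add: st)
  moreover have "w\<^sub>P \<in> Hom N N id \<theta>'" "x\<^sub>P \<in> Hom N N \<theta>' (\<theta>' \<circ> \<theta>')"
    using w\<^sub>P_Hom x\<^sub>P_Hom by (simp_all add: Hom_def \<theta>')
  ultimately show ?thesis
    unfolding Q_system_def hprod_def d[symmetric]
    using \<theta>'(2) counit_left eqs w\<^sub>P_norm x\<^sub>P_norm by (simp add: st(1))
qed

end

end

text \<open>Both \<open>\<alpha>' s * t\<close> and \<open>S\<close> are isometries with range
  \<open>f * \<alpha>' e\<close>; the unitary compares these two parametrisations of the same
  corner.\<close>

lemma (in reduced_pair) reduced_Q_equivalent:
  assumes S: "S \<in> N" "is_isometry S" "S * adj S = f * \<alpha>' e"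
    and \<beta>: "\<And>n. n \<in> N \<Longrightarrow> \<beta> n = adj s * \<alpha> n * s"
    and \<theta>': "\<And>n. n \<in> N \<Longrightarrow> \<theta>' n = adj S * \<alpha>' (\<alpha> n) * S"
  shows "Q_equivalent N ((\<lambda>m. adj t * \<alpha>' m * t) \<circ> \<beta>)
    (adj t * \<alpha>' (adj s) * w) (adj t * \<alpha>' (adj s * \<alpha> (adj t) * w') * t)
    \<theta>' (adj S * w) (adj S * \<alpha>' (\<alpha> (adj S)) * \<alpha>' w' * S)"
proof -
  interpret Q: reduced_Q N M \<alpha> \<alpha>' w w' e f S by unfold_locales (use S in auto)
  have Es: "\<alpha>' e * \<alpha>' s = \<alpha>' s" "adj (\<alpha>' s) * \<alpha>' e = adj (\<alpha>' s)"
    using hom_simps(10)[of e s] hom_simps(10)[of "adj s" e] by simp_all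
  have tt: "\<alpha>' (\<alpha> t) * adj (\<alpha>' (\<alpha> t)) = \<alpha>' (\<alpha> f)"
    using hom_simps(10)[of "\<alpha> t" "adj (\<alpha> t)"] by (simp add: image_ss)
  note rules = Q.left_rules image_ss(1,3) image_ss(1,3)[THEN mult_cont] Es Es[THEN mult_cont]
    tt tt[THEN mult_cont] Q.X_move(1)[OF s(1)] Q.X_move(1)[OF s(1), THEN mult_cont]
  define u where "u = adj S * \<alpha>' s * t"
  have u: "u \<in> N" by (simp add: u_def)
  have "is_unitary u" by (simp add: is_unitary_def u_def rules)
  moreover have "u \<in> Hom N N ((\<lambda>m. adj t * \<alpha>' m * t) \<circ> \<beta>) \<theta>'"
    unfolding Hom_def using u by (auto simp: \<beta> \<theta>' u_def rules)
  moreover have "adj S * w = u * (adj t * \<alpha>' (adj s) * w)"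
    by (simp add: u_def rules)
  moreover have "adj S * \<alpha>' (\<alpha> (adj S)) * \<alpha>' w' * S * u
      = hprod ((\<lambda>m. adj t * \<alpha>' m * t) \<circ> \<beta>) u u * (adj t * \<alpha>' (adj s * \<alpha> (adj t) * w') * t)"
    unfolding hprod_def comp_def \<beta>[OF u] by (simp add: u_def rules)
  ultimately show ?thesis unfolding Q_equivalent_def by blast
qed

section \<open>Reducing projections of the extension\<close>

lemma dim_values_nonneg:
  assumes "D \<in> dim_values N M \<alpha>" "factor (N :: 'h::chilbert_space bop set)"
  shows "0 \<le> D"
proof -
  obtain w :: "'h bop" where "adj w * w = complex_of_real D *\<^sub>C 1"
    using assms(1) unfolding dim_values_def by blast
  from adj_mult_self_scalar[OF this factor_nonzero[OF assms(2)]] show ?thesis by simp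
qed

lemma hom_dim_le:
  assumes "D \<in> dim_values N M \<alpha>" "factor (N :: 'h::chilbert_space bop set)"
  shows "hom_dim N M \<alpha> \<le> D"
  unfolding hom_dim_def
  by (rule cInf_lower[OF assms(1)], rule bdd_belowI[of _ 0]) (rule dim_values_nonneg[OF _ assms(2)])

section \<open>The extension as a conjugate pair, and its minimality\<close>

locale factor_extension =
  fixes N :: "'h::chilbert_space bop set" and M :: "'k::chilbert_space bop set"
    and C :: "('h bop \<Rightarrow> 'h bop) set" and \<theta> w x \<iota> v \<iota>'
  assumes factors: "factor N" "factor M" and C: "tensor_subcategory N C"
    and Q: "Q_system N C \<theta> w x" and ext: "Q_extension N \<theta> w x M \<iota> v \<iota>'"
begin

sublocale N: vn_algebra N by (rule factor_vn[OF factors(1)])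
sublocale M: vn_algebra M by (rule factor_vn[OF factors(2)])

lemma \<theta>_hom: "star_hom N N \<theta>"
proof -
  have "\<theta> \<in> C" using Q unfolding Q_system_def by blast
  then show ?thesis using C unfolding tensor_subcategory_def by blast
qed

lemma \<iota>_hom: "star_hom N M \<iota>"
  using ext by (simp add: Q_extension_def)

definition "d = sqrt (hom_dim N N \<theta>)"

lemma wx_Hom: "w \<in> Hom N N id \<theta>" "x \<in> Hom N N \<theta> (\<theta> \<circ> \<theta>)"
  using Q unfolding Q_system_def by blast+

lemma wx_closed [simp]: "w \<in> N" "x \<in> N" "v \<in> M"
proof -
  show "v \<in> M" using ext unfolding Q_extension_def by blast
qed (use wx_Hom in \<open>auto simp: Hom_def\<close>)

lemmas \<theta>_simps [simp] = star_homD[OF \<theta>_hom]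

lemma Q_rules:
  "n \<in> N \<Longrightarrow> w * n = \<theta> n * w" "n \<in> N \<Longrightarrow> x * \<theta> n = \<theta> (\<theta> n) * x"
  "adj w * x = 1" "adj (\<theta> w) * x = 1" "\<theta> x * x = x * x" "adj (\<theta> x) * x = x * adj x"
  "adj w * w = complex_of_real d *\<^sub>C 1" "adj x * x = complex_of_real d *\<^sub>C 1"
proof -
  have raw: "adj w * \<theta> 1 * x = 1" "1 * \<theta> (adj w) * x = 1" "x * \<theta> 1 * x = 1 * \<theta> x * x"
    "1 * \<theta> (adj x) * (x * \<theta> 1) = x * adj x"
    using Q unfolding Q_system_def hprod_def by blast+
  show "adj w * x = 1" "adj (\<theta> w) * x = 1" "adj (\<theta> x) * x = x * adj x"
    using raw by simp_all
  show "\<theta> x * x = x * x" using raw(3) by (simp only: \<theta>_simps(1) mult_1_left mult_1_right)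
  show "adj w * w = complex_of_real d *\<^sub>C 1" "adj x * x = complex_of_real d *\<^sub>C 1"
    using Q unfolding Q_system_def d_def by blast+
  show "n \<in> N \<Longrightarrow> w * n = \<theta> n * w" "n \<in> N \<Longrightarrow> x * \<theta> n = \<theta> (\<theta> n) * x"
    using HomD(2)[OF wx_Hom(1), of n] HomD(2)[OF wx_Hom(2), of n] by simp_all
qed

lemma ext_rules:
  "n \<in> N \<Longrightarrow> v * \<iota> n = \<iota> (\<theta> n) * v" "v * v = \<iota> x * v" "adj v = \<iota> (adj w * adj x) * v"
  "\<iota> (adj w) * v = 1" "n \<in> N \<Longrightarrow> \<iota>' (\<iota> n * v) = \<theta> n * x"
proof -
  show "v * v = \<iota> x * v" "adj v = \<iota> (adj w * adj x) * v" "\<iota> (adj w) * v = 1"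
    "n \<in> N \<Longrightarrow> v * \<iota> n = \<iota> (\<theta> n) * v" "n \<in> N \<Longrightarrow> \<iota>' (\<iota> n * v) = \<theta> n * x"
    using ext unfolding Q_extension_def by metis+
qed

lemma M_cases:
  assumes "m \<in> M"
  obtains n where "n \<in> N" "m = \<iota> n * v"
  using ext assms unfolding Q_extension_def by blast

text \<open>Writing elements of \<open>M\<close> as \<open>\<iota> n * v\<close> turns each
  operation of \<open>M\<close> into one on coefficients. Coassociativity then gives
  multiplicativity, and the Frobenius relation gives compatibility with adjoints.\<close>

lemma \<iota>'_hom: "star_hom M N \<iota>'"
proof -
  note [simp] = star_homD[OF \<iota>_hom]
  have form: "\<iota> n * v + \<iota> m * v = \<iota> (n + m) * v" "\<iota> n * v * (\<iota> m * v) = \<iota> (n * \<theta> m * x) * v"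
    "c *\<^sub>C (\<iota> n * v) = \<iota> (c *\<^sub>C n) * v" "adj (\<iota> n * v) = \<iota> (adj w * adj x * \<theta> (adj n)) * v"
    if [simp]: "n \<in> N" "m \<in> N" for n m c
  proof -
    show "\<iota> n * v + \<iota> m * v = \<iota> (n + m) * v" by (simp add: distrib_right)
    have "\<iota> n * v * (\<iota> m * v) = \<iota> n * (v * \<iota> m) * v" by (simp add: mult.assoc)
    also have "\<dots> = \<iota> n * \<iota> (\<theta> m) * (v * v)" using ext_rules(1)[of m] by (simp add: mult.assoc)
    finally show "\<iota> n * v * (\<iota> m * v) = \<iota> (n * \<theta> m * x) * v" by (simp add: ext_rules mult.assoc)
    have "adj (\<iota> n * v) = \<iota> (adj w * adj x) * (v * \<iota> (adj n))" by (simp add: ext_rules mult.assoc)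
    also have "v * \<iota> (adj n) = \<iota> (\<theta> (adj n)) * v" by (rule ext_rules) simp
    finally show "adj (\<iota> n * v) = \<iota> (adj w * adj x * \<theta> (adj n)) * v" by (simp add: mult.assoc)
  qed simp
  have img: "\<iota>' a \<in> N" if "a \<in> M" for a
    using that by (rule M_cases) (simp add: ext_rules)
  have "\<iota>' 1 = \<iota>' (\<iota> (adj w) * v)" by (simp only: ext_rules(4))
  also have "\<dots> = 1" using ext_rules(5)[of "adj w"] Q_rules(4) by simp
  finally have one: "\<iota>' 1 = 1" .
  have add: "\<iota>' (a + b) = \<iota>' a + \<iota>' b" and mult: "\<iota>' (a * b) = \<iota>' a * \<iota>' b"
    if "a \<in> M" "b \<in> M" for a b
  proof -
    obtain n where [simp]: "n \<in> N" and n: "a = \<iota> n * v" using M_cases[OF \<open>a \<in> M\<close>] .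
    obtain m where [simp]: "m \<in> N" and m: "b = \<iota> m * v" using M_cases[OF \<open>b \<in> M\<close>] .
    have k: "n + m \<in> N" "n * \<theta> m * x \<in> N" by simp_all
    show "\<iota>' (a + b) = \<iota>' a + \<iota>' b"
      unfolding n m form(1)[OF \<open>n \<in> N\<close> \<open>m \<in> N\<close>] ext_rules(5)[OF k(1)]
        ext_rules(5)[OF \<open>n \<in> N\<close>] ext_rules(5)[OF \<open>m \<in> N\<close>]
      by (simp add: distrib_right)
    show "\<iota>' (a * b) = \<iota>' a * \<iota>' b"
      unfolding n m form(2)[OF \<open>n \<in> N\<close> \<open>m \<in> N\<close>] ext_rules(5)[OF k(2)]
        ext_rules(5)[OF \<open>n \<in> N\<close>] ext_rules(5)[OF \<open>m \<in> N\<close>]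
      by (simp add: mult.assoc Q_rules(2)[THEN mult_cont] Q_rules(5))
  qed
  have scale: "\<iota>' (c *\<^sub>C a) = c *\<^sub>C \<iota>' a" and adj: "\<iota>' (adj a) = adj (\<iota>' a)" if "a \<in> M" for a c
  proof -
    obtain n where n: "n \<in> N" "a = \<iota> n * v" using M_cases[OF \<open>a \<in> M\<close>] .
    note [simp] = n(1)
    have k: "c *\<^sub>C n \<in> N" "adj w * adj x * \<theta> (adj n) \<in> N" by simp_all
    show "\<iota>' (c *\<^sub>C a) = c *\<^sub>C \<iota>' a"
      unfolding n(2) form(3)[OF n(1) n(1)] ext_rules(5)[OF k(1)] ext_rules(5)[OF n(1)] by simp
    have "adj (\<theta> (\<theta> n)) * x = x * adj (\<theta> n)" using Q_rules(2)[of "adj n"] by simp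
    moreover have "adj (\<theta> (\<theta> n) * x) = adj (x * \<theta> n)" by (simp only: Q_rules(2) n(1))
    moreover have "\<iota>' (adj a) = adj (\<theta> w) * (adj (\<theta> x) * (adj (\<theta> (\<theta> n)) * x))"
      unfolding n(2) form(4)[OF n(1) n(1)] ext_rules(5)[OF k(2)] by (simp add: mult.assoc)
    moreover have "adj (\<iota>' a) = adj x * adj (\<theta> n)" unfolding n(2) ext_rules(5)[OF n(1)] by simp
    ultimately show "\<iota>' (adj a) = adj (\<iota>' a)"
      by (simp add: Q_rules(6)[THEN mult_cont] mult.assoc Q_rules(4)[THEN mult_cont])
  qed
  show ?thesis unfolding star_hom_def using img one add mult scale adj by auto
qed

lemma \<iota>'_\<iota>: "n \<in> N \<Longrightarrow> \<iota>' (\<iota> n) = \<theta> n"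
  and \<iota>'_v: "\<iota>' v = x"
proof -
  note [simp] = star_homD[OF \<iota>_hom]
  show "\<iota>' v = x" using ext_rules(5)[of 1] by simp
  assume n [simp]: "n \<in> N"
  have "\<iota> n = \<iota> (n * adj w) * v" using ext_rules(4) by (simp add: mult.assoc)
  then have "\<iota>' (\<iota> n) = \<theta> (n * adj w) * x" using ext_rules(5)[of "n * adj w"] by simp
  then show "\<iota>' (\<iota> n) = \<theta> n" by (simp add: mult.assoc Q_rules)
qed

sublocale conjugate_factors N M \<iota> \<iota>' w v
proof (unfold_locales)
  note [simp] = star_homD[OF \<iota>_hom]
  have "v * m = \<iota> (\<iota>' m) * v" if m: "m \<in> M" for m
  proof -
    obtain n where [simp]: "n \<in> N" and n: "m = \<iota> n * v" using M_cases[OF m] .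
    have "v * m = \<iota> (\<theta> n) * (v * v)" unfolding n using ext_rules(1)[of n] by (metis \<open>n \<in> N\<close> mult.assoc)
    then show ?thesis unfolding n by (simp add: ext_rules mult.assoc)
  qed
  moreover have "adj (\<iota> w) * v = 1" using ext_rules(4) by simp
  ultimately show "conjugate_pair N M \<iota> \<iota>' w v"
    unfolding conjugate_pair_def
    using \<iota>_hom \<iota>'_hom by (auto simp: Hom_def Q_rules \<iota>'_\<iota> \<iota>'_v ext_rules)
qed (use factors in auto)

lemma adj_w_\<theta>: "n \<in> N \<Longrightarrow> adj w * \<theta> n = n * adj w"
  using adj_w_move(1)[of n] by (simp add: \<iota>'_\<iota>)

lemma v_norm: "adj v * v = complex_of_real d *\<^sub>C 1"
proof -
  have "adj v * v = \<iota> (adj w * (adj x * x)) * v"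
    by (simp add: ext_rules(3)) (simp add: ext_rules(2) mult.assoc)
  then show ?thesis using ext_rules(4) by (simp add: Q_rules)
qed

text \<open>\<open>w\<close> cannot vanish because \<open>adj w * x = 1\<close>. Positivity of the
  square root allows the dimension of \<theta> to be recovered from it.\<close>

lemma d_pos: "0 < d"
proof -
  have "w \<noteq> 0" using Q_rules(3) factor_nonzero[OF factors(1)] by auto
  then have "d \<noteq> 0" using adj_mult_self_zero[of w] Q_rules(7) by auto
  then show ?thesis
    using adj_mult_self_scalar[OF Q_rules(7) factor_nonzero[OF factors(1)]] by simp
qed

lemma hom_dim_\<theta>: "hom_dim N N \<theta> = d * d"
  using d_pos unfolding d_def by simp

lemma minimal_\<theta>: "D \<in> dim_values N N \<theta> \<Longrightarrow> d * d \<le> D"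
  using hom_dim_le[of D N N \<theta>, OF _ factors(1)] by (simp only: hom_dim_\<theta>)

lemma minimal_\<iota>:
  assumes "D \<in> dim_values N M \<iota>"
  shows "d \<le> D"
proof -
  obtain \<gamma> u u' where pair': "conjugate_pair N M \<iota> \<gamma> u u'"
    and u: "adj u * u = complex_of_real D *\<^sub>C 1" "adj u' * u' = complex_of_real D *\<^sub>C 1"
    using assms unfolding dim_values_def by blast
  interpret c: conjugate_factors N M \<iota> \<gamma> u u' by unfold_locales (use factors pair' in auto)
  \<comment> \<open>The conjugate of \<theta>, regarded as \<open>\<iota>' \<circ> \<iota>\<close>,
    is \<open>\<gamma> \<circ> \<iota>\<close>. \<open>U\<close> and \<open>U'\<close> are nested
    cups: \<open>v\<close> inside \<open>u\<close>, and \<open>u'\<close> inside \<open>w\<close>;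
    their moduli multiply.\<close>
  define U where "U = \<gamma> v * u"
  define U' where "U' = \<iota>' u' * w"
  have gi: "star_hom N N (\<gamma> \<circ> \<iota>)" unfolding star_hom_def by auto
  have gv: "\<gamma> v * \<gamma> (\<iota> n) = \<gamma> (\<iota> (\<theta> n)) * \<gamma> v" if "n \<in> N" for n
    using that c.hom_simps(10)[of v "\<iota> n"] by (simp add: ext_rules(1))
  have iu: "\<iota>' u' * \<theta> n = \<theta> (\<gamma> (\<iota> n)) * \<iota>' u'" if "n \<in> N" for n
    using that hom_simps(10)[of u' "\<iota> n"] by (simp add: c.w_move \<iota>'_\<iota>)
  have "adj v * \<iota> U' = u'" by (simp add: U'_def w_rules mult.assoc)
  then have "\<gamma> (adj v) * \<gamma> (\<iota> U') = \<gamma> u'"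
    using c.hom_simps(10)[of "adj v" "\<iota> U'"] by (simp add: U'_def del: c.hom_simps(12))
  then have "adj u * (\<gamma> (adj v) * \<gamma> (\<iota> U')) = 1" by (simp only: c.conj_eq)
  then have c1: "adj U * (\<gamma> \<circ> \<iota>) U' = 1" by (simp add: U_def mult.assoc)
  have "\<iota>' (\<iota> (adj U)) * U' = \<iota>' (adj (\<iota> u) * (adj (\<iota> (\<gamma> v)) * u')) * w"
    by (simp add: U_def U'_def mult.assoc)
  also have "adj (\<iota> (\<gamma> v)) * u' = u' * adj v" using c.w_move(2)[of "adj v"] by simp
  also have "adj (\<iota> u) * (u' * adj v) = adj v" by (simp add: c.conj_eq(2)[THEN mult_cont])
  also have "\<iota>' (adj v) * w = 1" by (simp add: w_rules)
  finally have c2: "\<theta> (adj U) * U' = 1" by (simp add: U_def \<iota>'_\<iota>)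
  have mem: "U \<in> N" "U' \<in> N" by (simp_all add: U_def U'_def)
  have "conjugate_pair N N \<theta> (\<gamma> \<circ> \<iota>) U U'"
    unfolding conjugate_pair_def using \<theta>_hom gi c1 c2 mem
    by (auto simp: Hom_def U_def U'_def mult.assoc c.w_rules gv gv[THEN mult_cont]
        Q_rules(1) iu iu[THEN mult_cont])
  moreover have "adj U * U = complex_of_real (d * D) *\<^sub>C 1"
  proof -
    have "adj U * U = adj u * (\<gamma> (adj v * v) * u)" by (simp add: U_def mult.assoc)
    then show ?thesis by (simp add: v_norm u)
  qed
  moreover have "adj U' * U' = complex_of_real (d * D) *\<^sub>C 1"
  proof -
    have "adj U' * U' = adj w * (\<iota>' (adj u' * u') * w)" by (simp add: U'_def mult.assoc)
    then show ?thesis by (simp add: Q_rules u mult.commute)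
  qed
  ultimately have "d * D \<in> dim_values N N \<theta>" unfolding dim_values_def by blast
  from minimal_\<theta>[OF this] show ?thesis using d_pos by simp
qed

section \<open>Equivalence of the three kinds of reducing data with projections of
  \<open>Hom N M \<iota> \<iota>\<close>\<close>

lemma reducing_of_projections:
  assumes "conjugate_projections N M \<iota> \<iota>' w v e q" and p: "p = \<iota>' e" and P: "P = q * p"
  shows "right_reducing N \<theta> w x p" "left_reducing N \<theta> w x q" "two_sided_reducing N \<theta> w x P"
    "q = hprod \<theta> (adj w * p) 1 * x" "p = hprod \<theta> 1 (adj w * q) * x"
    "q = hprod \<theta> (adj w * P) 1 * x" "p = hprod \<theta> 1 (adj w * P) * x"
proof -
  interpret c: conjugate_projections N M \<iota> \<iota>' w v e q by fact
  have pN [simp]: "p \<in> N" by (simp add: p)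
  have pn: "p * \<theta> n = \<theta> n * p" if "n \<in> N" for n
    using that hom_simps(10)[of e "\<iota> n"] hom_simps(10)[of "\<iota> n" e] c.e_right(1)[of n]
    by (simp add: p \<iota>'_\<iota>)
  have qn: "q * \<theta> n = \<theta> n * q" "q * x = x * q" "q * p = p * q" if "n \<in> N" for n
    using that c.f_right(1)[of "\<iota> n"] c.f_right(1)[of v] c.f_right(1)[of e] by (simp_all add: \<iota>'_\<iota> \<iota>'_v p)
  have pp: "p * p = p" "adj p = p"
    using hom_simps(10)[of e e] c.adj_images(1) by (simp_all add: p)
  have px: "\<theta> p * x = x * p"
    using hom_simps(10)[of v e] by (simp add: w_move p \<iota>'_\<iota> \<iota>'_v)
  have qx: "\<theta> q * x = p * x"
    using hom_simps(10)[of "\<iota> q" v] hom_simps(10)[of e v] c.ew by (simp add: p \<iota>'_\<iota> \<iota>'_v)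
  have wp: "adj w * p = adj w * q" and pw: "p * w = q * w"
    using c.adj_fw(1) c.fw by (simp_all add: p)
  have q: "q = adj w * (p * x)"
  proof -
    have "adj w * (p * x) = adj w * (q * x)" by (simp add: wp flip: mult.assoc)
    also have "\<dots> = q" by (simp add: qn(2)[OF N.closed(1)] mult_cont[OF Q_rules(3)])
    finally show ?thesis by simp
  qed
  have p': "p = adj (\<theta> w) * (\<theta> q * x)" "p = adj (\<theta> w) * (\<theta> p * x)"
  proof -
    have "\<theta> (adj w * q) = \<theta> (adj w * p)" by (simp only: wp)
    then have "adj (\<theta> w) * \<theta> q = adj (\<theta> w) * \<theta> p" by simp
    moreover have "adj (\<theta> w) * (\<theta> p * x) = p" by (simp add: px mult_cont[OF Q_rules(4)])
    ultimately show "p = adj (\<theta> w) * (\<theta> p * x)" "p = adj (\<theta> w) * (\<theta> q * x)"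
      by (metis mult.assoc)+
  qed
  \<comment> \<open>Against \<open>adj w\<close> the projections \<open>p\<close> and
    \<open>q\<close> are interchangeable, so their product contracts to the same element as either
    of them.\<close>
  have wP: "adj w * P = adj w * p" by (metis P c.ef_proj(3) mult.assoc pp(1) qn(3)[OF N.closed(1)] wp)
  show q1: "q = hprod \<theta> (adj w * p) 1 * x" using q by (simp add: hprod_def mult.assoc)
  show q2: "q = hprod \<theta> (adj w * P) 1 * x" unfolding wP by (rule q1)
  show p1: "p = hprod \<theta> 1 (adj w * q) * x" using p'(1) by (simp add: hprod_def mult.assoc)
  show p2: "p = hprod \<theta> 1 (adj w * P) * x" unfolding wP using p'(2) by (simp add: hprod_def mult.assoc)
  have projs: "is_proj p" "is_proj q" "is_proj P"
    using pp qn(3)[OF N.closed(1)]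
    by (auto simp: is_proj_def P) (metis c.ef_proj(3) mult.assoc)
  show "right_reducing N \<theta> w x p"
    unfolding right_reducing_def using projs q1 pw px pn by (auto simp: Hom_def hprod_def)
  show "left_reducing N \<theta> w x q"
    unfolding left_reducing_def using projs p1 pw qn by (auto simp: Hom_def hprod_def)
  \<comment> \<open>Moving the right contraction through the first \<open>x\<close> splits the
    threefold coproduct into the formula for \<open>q\<close> times the formula for
    \<open>p\<close>.\<close>
  have "hprod \<theta> (adj w * P) (hprod \<theta> 1 (adj w * P)) * (hprod \<theta> x 1 * x)
      = adj w * p * (\<theta> (\<theta> (adj w * p)) * x) * x"
    by (simp add: hprod_def wP mult.assoc)
  also have "\<dots> = adj w * p * (x * \<theta> (adj w * p)) * x" by (simp add: Q_rules(2)[of "adj w * p"] del: \<theta>_simps(4,6))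
  also have "\<dots> = (adj w * (p * x)) * (adj (\<theta> w) * (\<theta> p * x))" by (simp add: mult.assoc)
  also have "\<dots> = P" unfolding q[symmetric] p'(2)[symmetric] P ..
  finally show "two_sided_reducing N \<theta> w x P"
    unfolding two_sided_reducing_def using projs pn qn
    by (auto simp: Hom_def P mult.assoc pn[THEN mult_cont] qn(1)[THEN mult_cont])
qed

text \<open>Frobenius reciprocity: \<open>adj w * a\<close> intertwines \<theta> with the identity,
  and composing with \<open>v\<close> bends this into an endomorphism of \<iota>. Its image under
  \<open>\<iota>'\<close> is the expression by which (b) and (c) define \<open>p\<close>.\<close>

lemma Hom_of_Hom_\<theta>:
  assumes a: "a \<in> Hom N N \<theta> \<theta>"
  defines "e \<equiv> \<iota> (adj w * a) * v"
  shows "e \<in> Hom N M \<iota> \<iota>" "\<iota>' e = \<theta> (adj w * a) * x"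
proof -
  note [simp] = HomD(1)[OF a]
  have "adj w * (a * \<theta> n) = n * (adj w * a)" if "n \<in> N" for n
    using that HomD(2)[OF a that] adj_w_\<theta>[OF that] by (simp flip: mult.assoc)
  then have "\<iota> (adj w * a * \<theta> n) = \<iota> (n * (adj w * a))" if "n \<in> N" for n
    using that by (simp add: mult.assoc)
  then have "\<iota> (adj w * a) * \<iota> (\<theta> n) = \<iota> n * \<iota> (adj w * a)" if "n \<in> N" for n
    using that hom_simps(4)[of "adj w * a" "\<theta> n"] hom_simps(4)[of n "adj w * a"] by simp
  then have "\<iota> (adj w * a) * (v * \<iota> n) = \<iota> n * (\<iota> (adj w * a) * v)" if "n \<in> N" for n
    using that ext_rules(1)[OF that] by (metis mult.assoc)
  then show "e \<in> Hom N M \<iota> \<iota>" unfolding e_def by (simp add: Hom_def mult.assoc)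
  show "\<iota>' e = \<theta> (adj w * a) * x" unfolding e_def by (rule ext_rules(5)) simp
qed

text \<open>The first clause on \<open>p\<close> says that it comes from
  \<open>Hom N M \<iota> \<iota>\<close>. The second gives \<open>(q - adj q) * w = 0\<close>, and
  Frobenius reciprocity then makes \<open>q\<close> self-adjoint.\<close>

lemma projections_of_right_reducing:
  assumes p: "right_reducing N \<theta> w x p" and q: "q = hprod \<theta> (adj w * p) 1 * x"
  shows "\<exists>e. conjugate_projections N M \<iota> \<iota>' w v e q \<and> p = \<iota>' e"
proof -
  interpret dual: conjugate_factors M N \<iota>' \<iota> v w by (rule dual)
  have pH: "p \<in> Hom N N \<theta> \<theta>" and pp: "p * p = p" "adj p = p" and px: "\<theta> p * x = x * p"
    and pw: "p * w = q * w"
    using p q by (auto simp: right_reducing_def is_proj_def hprod_def)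
  note [simp] = HomD(1)[OF pH]
  define e where "e = \<iota> (adj w * p) * v"
  note e = Hom_of_Hom_\<theta>[OF pH, folded e_def]
  note [simp] = HomD(1)[OF e(1)]
  have ie: "\<iota>' e = p" unfolding e by (simp add: mult.assoc px mult_cont[OF Q_rules(4)])
  have "e * e = e" by (rule \<alpha>'_inj) (simp_all add: ie pp)
  moreover have "adj e = e" by (rule \<alpha>'_inj) (simp_all add: ie pp)
  ultimately have proj: "is_proj e" by (simp add: is_proj_def)
  have qe: "q = adj w * \<iota>' e * \<iota>' v" using q by (simp add: hprod_def ie \<iota>'_v)
  note c = conjugate_Hom[OF e(1), folded qe]
  have "adj q \<in> Hom M N \<iota>' \<iota>'" by (rule Hom_adj) (use c hom hom' in \<open>auto intro: N.vn_algebra_axioms M.vn_algebra_axioms\<close>)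
  then have diff: "q - adj q \<in> Hom M N \<iota>' \<iota>'" using c(1) by (auto simp: Hom_def algebra_simps)
  have "adj q * w = p * w" using arg_cong[OF c(3), of adj] by (simp add: ie pp)
  then have "(q - adj q) * w = 0" using pw by (simp add: left_diff_distrib)
  from dual.Hom_mult_w'_zero[OF diff this] have "adj q = q" by simp
  then show ?thesis using conjugate_projectionsI[OF e(1) proj qe] ie by blast
qed

text \<open>The mirror case: \<open>q\<close> is a projection by assumption, while \<open>e\<close>
  has to be shown self-adjoint and idempotent. Both are tested after contraction with
  \<open>w\<close>.\<close>

lemma projections_of_left_reducing:
  assumes q: "left_reducing N \<theta> w x q" and p: "p = hprod \<theta> 1 (adj w * q) * x"
  shows "\<exists>e. conjugate_projections N M \<iota> \<iota>' w v e q \<and> p = \<iota>' e"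
proof -
  interpret dual: conjugate_factors M N \<iota>' \<iota> v w by (rule dual)
  have qH: "q \<in> Hom N N \<theta> \<theta>" and qq: "q * q = q" "adj q = q" and qx: "q * x = x * q"
    and pw: "q * w = p * w"
    using p q by (auto simp: left_reducing_def is_proj_def hprod_def)
  note [simp] = HomD(1)[OF qH]
  define e where "e = \<iota> (adj w * q) * v"
  note e = Hom_of_Hom_\<theta>[OF qH, folded e_def]
  note [simp] = HomD(1)[OF e(1)]
  have ie: "\<iota>' e = p" unfolding e p by (simp add: hprod_def)
  have "adj w * \<iota>' e * \<iota>' v = adj w * \<theta> (adj w * q) * (x * x)"
    unfolding ie p hprod_def \<iota>'_v by (simp only: mult_1_left mult.assoc)
  also have "\<dots> = adj w * q * (adj w * x) * x"
  proof -
    have "adj w * \<theta> (adj w * q) = adj w * q * adj w" by (rule adj_w_\<theta>) simp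
    then show ?thesis by (simp only: mult.assoc)
  qed
  also have "\<dots> = q" by (simp add: Q_rules mult.assoc qx mult_cont[OF Q_rules(3)])
  finally have qe: "q = adj w * \<iota>' e * \<iota>' v" by simp
  note c = conjugate_Hom[OF e(1), folded qe]
  have wp: "adj w * p = adj w * q" using c(3) by (simp add: ie)
  have "adj w * \<iota>' (e - adj e) = adj w * p - adj w * adj p" by (simp add: right_diff_distrib ie)
  also have "adj w * adj p = adj w * p" using arg_cong[OF pw, of adj] wp qq by simp
  finally have "e - adj e = 0" by (intro \<alpha>'_zero) simp_all
  then have "adj e = e" by simp
  moreover have "e * e = e"
  proof -
    \<comment> \<open>Under \<open>adj w\<close> each \<open>p\<close> may be traded for
      \<open>q\<close> in turn, and \<open>q\<close> is idempotent.\<close>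
    have "q * p = p * q" using dual.Hom_move(1)[OF c(1), of e] by (simp add: ie)
    then have "adj w * (p * p) = adj w * p" by (metis mult.assoc qq(1) wp)
    then have "adj w * \<iota>' (e * e - e) = 0" by (simp add: ie right_diff_distrib)
    from \<alpha>'_zero[OF _ this] show ?thesis by simp
  qed
  ultimately have "is_proj e" by (simp add: is_proj_def)
  then show ?thesis using conjugate_projectionsI[OF e(1) _ qe qq(2)] ie by blast
qed

text \<open>Here selfadjointness of \<open>P = q p\<close> passes to the factors: contracting \<open>P\<close> with \<open>v\<close> on either
  side leaves a common scalar multiple of \<open>e\<close> respectively \<open>q\<close>.\<close>

lemma projections_of_two_sided_reducing:
  assumes P: "two_sided_reducing N \<theta> w x P"
    and q: "q = hprod \<theta> (adj w * P) 1 * x" and p: "p = hprod \<theta> 1 (adj w * P) * x"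
  shows "P = q * p \<and> (\<exists>e. conjugate_projections N M \<iota> \<iota>' w v e q \<and> p = \<iota>' e)"
proof -
  interpret dual: conjugate_factors M N \<iota>' \<iota> v w by (rule dual)
  have PH: "P \<in> Hom N N \<theta> \<theta>" and PP: "P * P = P" "adj P = P"
    and eq: "adj w * P * \<theta> (\<theta> (adj w * P)) * (x * x) = P"
    using P by (auto simp: two_sided_reducing_def is_proj_def hprod_def)
  note [simp] = HomD(1)[OF PH]
  define e where "e = \<iota> (adj w * P) * v"
  note e = Hom_of_Hom_\<theta>[OF PH, folded e_def]
  note [simp] = HomD(1)[OF e(1)]
  have ie: "\<iota>' e = p" unfolding e p by (simp add: hprod_def)
  have q': "q = adj w * P * x" using q by (simp add: hprod_def)
  have p': "p = \<theta> (adj w * P) * x" using p by (simp add: hprod_def)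
  have wn: "adj w * \<theta> (adj w * P) = adj w * P * adj w"
    by (rule adj_w_\<theta>) simp
  have "adj w * \<iota>' e * \<iota>' v = adj w * \<theta> (adj w * P) * (x * x)"
    unfolding ie p' \<iota>'_v by (simp only: mult.assoc)
  also have "\<dots> = adj w * P * (adj w * x) * x" unfolding wn by (simp only: mult.assoc)
  also have "\<dots> = q" by (simp add: Q_rules q')
  finally have qe: "q = adj w * \<iota>' e * \<iota>' v" by simp
  note c = conjugate_Hom[OF e(1), folded qe]
  have [simp]: "q \<in> N" using HomD(1)[OF c(1)] .
  have "P = adj w * P * (\<theta> (\<theta> (adj w * P)) * x) * x" using eq by (simp only: mult.assoc)
  also have "\<theta> (\<theta> (adj w * P)) * x = x * \<theta> (adj w * P)" by (simp only: Q_rules(2) N.closed wx_closed \<open>P \<in> N\<close>)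
  finally have Pqp: "P = q * p" unfolding q' p' by (simp only: mult.assoc)
  have "adj w * p = adj w * P * (adj w * x)" unfolding p' using wn by (metis mult.assoc)
  then have wpP: "adj w * p = adj w * P" by (simp add: Q_rules)
  have wp: "adj w * p = adj w * q" using c(3) by (simp add: ie)
  \<comment> \<open>The first \<open>p\<close> is traded for \<open>q\<close>, giving
    \<open>adj w * P\<close>, which is \<open>adj w * p\<close> again.\<close>
  have "adj w * (p * p) = adj w * p" by (metis Pqp mult.assoc wp wpP)
  then have "adj w * \<iota>' (e * e - e) = 0" by (simp add: ie right_diff_distrib)
  from \<alpha>'_zero[OF _ this] have ee: "e * e = e" by simp
  obtain k where k: "adj v * (e * v) = k *\<^sub>C 1" using scalar_of_Hom[OF e(1)] by blast
  have vp: "\<iota> p * v = v * e" using w_move(2)[of e] by (simp add: ie)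
  have "adj v * \<iota> P * v = adj v * (\<iota> q * (\<iota> p * v))" by (simp add: Pqp ie[symmetric] mult.assoc)
  also have "\<dots> = adj v * (e * v) * e" unfolding vp by (metis c(2) mult.assoc)
  also have "\<dots> = k *\<^sub>C e" unfolding k by simp
  finally have vPv: "adj v * \<iota> P * v = k *\<^sub>C e" .
  have "adj (\<iota> P) = \<iota> P" using hom_simps(6)[of P] PP by simp
  then have ke: "k *\<^sub>C e = cnj k *\<^sub>C adj e"
    using arg_cong[OF vPv, of adj] vPv by (simp add: mult.assoc)
  have e0: "e = 0 \<or> k \<noteq> 0 \<and> adj e = e"
  proof (cases "k = 0")
    case True
    \<comment> \<open>If k = 0, then \<open>\<iota> P * v\<close> has modulus zero, so
      \<open>e * v * e = 0\<close>; contracting with \<open>\<iota> (adj w)\<close> leaves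
      \<open>e * e = 0\<close>.\<close>
    have "adj (\<iota> P * v) * (\<iota> P * v) = adj v * \<iota> (P * P) * v"
      using \<open>adj (\<iota> P) = \<iota> P\<close> by (simp add: mult.assoc)
    then have "\<iota> P * v = 0" using adj_mult_self_zero[of "\<iota> P * v"] by (simp add: PP vPv True)
    then have "e * v * e = 0" using vp c(2) by (simp add: Pqp ie[symmetric] mult.assoc) (metis ie mult.assoc)
    then have "\<iota> (adj w) * (e * v * e) = 0" by simp
    moreover have "\<iota> (adj w) * (e * v * e) = e * (\<iota> (adj w) * v) * e"
      by (simp add: mult.assoc Hom_move[OF e(1), THEN mult_cont])
    ultimately show ?thesis using ext_rules(4) ee by simp
  next
    case False
    \<comment> \<open>\<open>ke\<close> gives \<open>adj e = r *\<^sub>C e\<close>. As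
      \<open>adj e\<close> is idempotent, a nonzero \<open>e\<close> forces r * r = r, and r is
      nonzero, so r = 1.\<close>
    define r where "r = k / cnj k"
    have "adj e = (inverse (cnj k)) *\<^sub>C (cnj k *\<^sub>C adj e)" using False by simp
    then have ae: "adj e = r *\<^sub>C e" unfolding ke[symmetric] by (simp add: r_def divide_inverse mult.commute)
    have "adj e * adj e = adj e" using arg_cong[OF ee, of adj] by simp
    then have "(r * r - r) *\<^sub>C e = 0" unfolding ae by (simp add: ee bop_scaleC_linear)
    then have "r * (r - 1) = 0 \<or> e = 0"
      by (metis bop_scaleC(3,4,6) left_inverse right_diff_distrib mult.right_neutral)
    moreover have "r \<noteq> 0" using False by (simp add: r_def)
    ultimately have "e = 0 \<or> r = 1" by auto
    then show ?thesis using ae False by auto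
  qed
  then have ae: "adj e = e" by auto
  have proj: "is_proj e" using ee ae by (simp add: is_proj_def)
  have "adj q = q"
  proof (cases "e = 0")
    case True
    then show ?thesis by (simp add: qe)
  next
    case False
    then have k0: "k \<noteq> 0" using e0 by blast
    have "(k - cnj k) *\<^sub>C e = 0" using ke ae by (simp add: bop_scaleC_linear)
    then have kr: "cnj k = k" using False by (metis bop_scaleC(3,4,6) left_inverse right_minus_eq)
    have "adj x * q = q * adj x" using dual.Hom_move(2)[OF c(1), of v] by (simp add: \<iota>'_v)
    moreover have "adj x * (p * x) = k *\<^sub>C 1"
      using arg_cong[OF k, of \<iota>'] by (simp add: ie \<iota>'_v)
    ultimately have xPx: "adj x * P * x = k *\<^sub>C q"
      by (simp add: Pqp mult.assoc) (simp add: mult.assoc[symmetric]; simp add: mult.assoc)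
    have "adj (adj x * P * x) = adj x * P * x" by (simp add: PP mult.assoc)
    then have "cnj k *\<^sub>C adj q = k *\<^sub>C q" unfolding xPx by simp
    then have "inverse k *\<^sub>C (k *\<^sub>C adj q) = inverse k *\<^sub>C (k *\<^sub>C q)" unfolding kr by simp
    then show ?thesis using k0 by simp
  qed
  with conjugate_projectionsI[OF e(1) proj qe] ie Pqp show ?thesis by blast
qed

end

section \<open>Ranges of projections, the direct sum and the reduced Q-system\<close>

context factor_extension
begin

lemma range_exists:
  assumes "e \<in> Hom N M \<iota> \<iota>" "is_proj e" "e \<noteq> 0"
  shows "\<exists>\<beta>. range_of_proj N M \<iota> e \<beta>"
proof -
  obtain s where "s \<in> M" "is_isometry s" "s * adj s = e"
    using isometry_onto_Hom[OF assms] by blast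
  then have "range_of_proj N M \<iota> e (\<lambda>n. adj s * \<iota> n * s)"
    unfolding range_of_proj_def using assms by blast
  then show ?thesis by blast
qed

lemma range_star_hom:
  assumes "range_of_proj N M \<iota> e \<beta>"
  shows "star_hom N M \<beta>"
proof -
  obtain s where s: "s \<in> M" "is_isometry s" "s * adj s = e"
      and \<beta>: "\<And>n. n \<in> N \<Longrightarrow> \<beta> n = adj s * \<iota> n * s" and e: "e \<in> Hom N M \<iota> \<iota>"
    using assms unfolding range_of_proj_def by blast
  have "star_hom N M (\<lambda>n. adj s * \<iota> n * s)"
    by (rule star_hom_reduced[OF hom N.vn_algebra_axioms M.vn_algebra_axioms e s])
  then show ?thesis
    using star_hom_cong[OF N.vn_algebra_axioms, of \<beta> "\<lambda>n. adj s * \<iota> n * s" M] \<beta> by simp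
qed

text \<open>For \<open>e = 1\<close> the complementary projection is zero and has no range, so the
  direct sum degenerates to a unitary equivalence.\<close>

lemma range_one:
  assumes "range_of_proj N M \<iota> 1 \<beta>"
  shows "unitarily_equivalent N M \<iota> \<beta>"
proof -
  obtain s where s: "s \<in> M" "adj s * s = 1" "s * adj s = 1"
      and \<beta>: "\<And>n. n \<in> N \<Longrightarrow> \<beta> n = adj s * \<iota> n * s"
    using assms unfolding range_of_proj_def is_isometry_def by blast
  have "adj s \<in> Hom N M \<iota> \<beta>" using s by (auto simp: Hom_def \<beta> mult.assoc)
  moreover have "is_unitary (adj s)" using s by (simp add: is_unitary_def)
  ultimately show ?thesis unfolding unitarily_equivalent_def by blast
qed

lemma direct_sum_ranges:
  assumes "range_of_proj N M \<iota> e \<beta>" "range_of_proj N M \<iota> (1 - e) \<gamma>"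
  shows "direct_sum N M \<iota> \<beta> \<gamma>"
proof -
  obtain s where s: "s \<in> M" "is_isometry s" "s * adj s = e"
      and \<beta>: "\<And>n. n \<in> N \<Longrightarrow> \<beta> n = adj s * \<iota> n * s" and e: "e \<in> Hom N M \<iota> \<iota>" "is_proj e"
    using assms(1) unfolding range_of_proj_def by blast
  obtain t where t: "t \<in> M" "is_isometry t" "t * adj t = 1 - e"
      and \<gamma>: "\<And>n. n \<in> N \<Longrightarrow> \<gamma> n = adj t * \<iota> n * t"
    using assms(2) unfolding range_of_proj_def by blast
  have iso: "adj s * s = 1" "adj t * t = 1" using s t by (simp_all add: is_isometry_def)
  have "adj s * t = (adj s * s) * (adj s * t) * (adj t * t)" by (simp add: iso)
  also have "\<dots> = adj s * (s * adj s) * (t * adj t) * t" by (simp only: mult.assoc)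
  also have "\<dots> = 0" unfolding s(3) t(3) using is_projD(1)[OF e(2)] by (simp add: algebra_simps)
  finally have st: "adj s * t = 0" .
  have "\<iota> n = s * \<beta> n * adj s + t * \<gamma> n * adj t" if n: "n \<in> N" for n
  proof -
    have "s * \<beta> n * adj s + t * \<gamma> n * adj t
        = (s * adj s) * \<iota> n * (s * adj s) + (t * adj t) * \<iota> n * (t * adj t)"
      by (simp add: \<beta> \<gamma> n mult.assoc)
    also have "\<dots> = \<iota> n"
      unfolding s(3) t(3)
      using is_projD(1)[OF e(2)] Hom_move(1)[OF e(1) n] mult_cont[OF is_projD(1)[OF e(2)]]
      by (simp add: algebra_simps)
    finally show ?thesis by simp
  qed
  moreover have "s * adj s + t * adj t = 1" by (simp add: s t)
  ultimately show ?thesis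
    unfolding direct_sum_def
    using hom assms[THEN range_star_hom] s(1,2) t(1,2) st by blast
qed

lemma reduced_Q_system:
  assumes cp: "conjugate_projections N M \<iota> \<iota>' w v e q" and P: "P = q * \<iota>' e" "P \<noteq> 0"
    and S: "S \<in> N" "is_isometry S" "S * adj S = P"
  defines "\<theta>' \<equiv> \<lambda>n. adj S * \<theta> n * S" and "w' \<equiv> adj S * w"
    and "x' \<equiv> hprod \<theta> (adj S) (adj S) * x * S"
  shows "adj S * adj x * hprod \<theta> P P * x * S = complex_of_real (sqrt (hom_dim N N \<theta>')) *\<^sub>C 1"
    and "Q_system N C \<theta>' w' x'"
    and "range_of_proj N M \<iota> e \<beta> \<Longrightarrow> Q_system_of_hom N M \<beta> \<theta>' w' x'"
proof -
  interpret c: conjugate_projections N M \<iota> \<iota>' w v e q by (rule cp)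
  interpret dual: conjugate_projections M N \<iota>' \<iota> v w q e by (rule c.dual_projections)
  interpret r: reduced_Q N M \<iota> \<iota>' w v e q S by unfold_locales (use S P in auto)
  obtain k where k: "adj v * (e * v) = k *\<^sub>C 1" using scalar_of_Hom[OF c.e(1)] by blast
  obtain k' where k': "adj w * (q * w) = k' *\<^sub>C 1" using dual.scalar_of_Hom[OF c.f(1)] by blast
  have ev: "adj (e * v) * (e * v) = k *\<^sub>C 1" using k by (simp add: mult.assoc)
  have qw: "adj (q * w) * (q * w) = k' *\<^sub>C 1" using k' by (simp add: mult.assoc)
  define a where "a = Re k"
  have real: "k = complex_of_real (Re k)" "k' = complex_of_real (Re k')" and a0: "0 \<le> a"
    using adj_mult_self_scalar[OF ev factor_nonzero[OF factors(2)]]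
      adj_mult_self_scalar[OF qw factor_nonzero[OF factors(1)]] unfolding a_def by blast+
  have kk: "adj w * q * w = complex_of_real (Re k') *\<^sub>C 1" "adj v * e * v = complex_of_real a *\<^sub>C 1"
    unfolding a_def real[symmetric] mult.assoc by (fact k' k)+
  \<comment> \<open>The loops over \<open>q\<close> and over \<open>e\<close> live in different
    algebras; minimality of the pair \<open>(w, v)\<close> forces their values to agree.\<close>
  have "Re k' = a" by (rule c.minimal_balanced[OF Q_rules(7) v_norm d_pos minimal_\<iota> kk])
  with kk have c: "adj w * q * w = complex_of_real a *\<^sub>C 1" "adj v * e * v = complex_of_real a *\<^sub>C 1"
    by simp_all
  have rP: "r.w\<^sub>P = w'" "r.x\<^sub>P = x'" "r.\<theta>\<^sub>P n = \<theta>' n" if "n \<in> N" for n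
    using that S(1) by (simp_all add: r.P_defs w'_def x'_def \<theta>'_def hprod_def \<iota>'_\<iota> \<iota>'_v)
  have PN [simp]: "P \<in> N" using S by auto
  have "q * \<iota>' e * \<iota>' (\<iota> n) = \<iota>' (\<iota> n) * (q * \<iota>' e)" if "n \<in> N" for n
    using that
    by (simp add: mult.assoc r.E_right(1) r.E_right(1)[THEN mult_cont] c.f_right(1) c.f_right(1)[THEN mult_cont])
  then have P_Hom: "P \<in> Hom N N \<theta> \<theta>"
    by (simp add: Hom_def) (simp add: P(1) \<iota>'_\<iota>)
  have P_proj: "is_proj P"
  proof -
    have "S * adj S * (S * adj S) = S * (adj S * S) * adj S" by (simp only: mult.assoc)
    then show ?thesis using S(2) by (simp add: is_proj_def is_isometry_def flip: S(3))
  qed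
  have "adj (\<theta> x) * x = x * adj x" by (rule Q_rules)
  then have "adj (adj (\<theta> x) * x) = adj (x * adj x)" by simp
  then have xx: "adj x * \<theta> x = x * adj x" by simp
  \<comment> \<open>The Frobenius relation and the unit laws make \<theta> its own conjugate through
    \<open>x * w\<close>.\<close>
  have xw: "adj (x * w) * \<theta> (x * w) = 1"
  proof -
    have "adj (x * w) * \<theta> (x * w) = adj w * (adj x * \<theta> x) * \<theta> w" by (simp add: mult.assoc)
    also have "\<dots> = (adj w * x) * adj (adj (\<theta> w) * x)" unfolding xx by (simp add: mult.assoc)
    finally show ?thesis by (simp add: Q_rules)
  qed
  have "adj (adj (x * w) * \<theta> (x * w)) = 1" by (simp only: xw adj_one)
  then have xw': "\<theta> (adj (x * w)) * (x * w) = 1" by (simp add: mult.assoc)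
  have xw_Hom: "x * w \<in> Hom N N id (\<theta> \<circ> \<theta>)"
    by (auto simp: Hom_def mult.assoc Q_rules(1) Q_rules(2)[THEN mult_cont])
  have self: "\<theta> P * (x * w) = P * (x * w)"
    using r.self_conjugate[OF c] \<iota>'_\<iota>[of P] by (simp only: P(1)[symmetric] \<iota>'_v PN)
  \<comment> \<open>Both projections are \<open>P\<close> and both isometries are \<open>S\<close>,
    because \<open>P\<close> is its own conjugate for this pair.\<close>
  interpret t: reduced_pair N N \<theta> \<theta> "x * w" "x * w" P P S S
    by unfold_locales
      (use factors \<theta>_hom xw xw' xw_Hom self P_Hom P_proj S in \<open>auto simp: conjugate_pair_def\<close>)
  have xw_norm: "adj (x * w) * (x * w) = complex_of_real (d * d) *\<^sub>C 1"
  proof -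
    have "adj (x * w) * (x * w) = adj w * (adj x * x) * w" by (simp add: mult.assoc)
    then show ?thesis by (simp add: Q_rules)
  qed
  have self_norm: "adj (x * w) * P * (x * w) = complex_of_real (a * a) *\<^sub>C 1"
    using r.self_conjugate_norm[OF c] by (simp only: P(1)[symmetric] \<iota>'_v of_real_mult)
  have "hom_dim N N \<theta>' = a * a"
    by (rule t.reduced_standard(2)[OF xw_norm xw_norm minimal_\<theta> self_norm self_norm])
      (simp_all add: \<theta>'_def)
  then have dim: "sqrt (hom_dim N N \<theta>') = a" using a0 by simp
  have "P * \<theta> P = q * \<iota>' e * \<iota>' (\<iota> (q * \<iota>' e))" using \<iota>'_\<iota>[OF PN] P(1) by simp
  then show "adj S * adj x * hprod \<theta> P P * x * S = complex_of_real (sqrt (hom_dim N N \<theta>')) *\<^sub>C 1"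
    using r.n\<^sub>P[OF c] unfolding dim hprod_def \<iota>'_v by (simp only:)
  have "subobject N N \<theta>' \<theta>"
    unfolding subobject_def range_of_proj_def \<theta>'_def using P_Hom P_proj S by blast
  moreover have "\<theta> \<in> C" using Q unfolding Q_system_def by blast
  ultimately have "\<theta>' \<in> C" using C unfolding tensor_subcategory_def by blast
  then show "Q_system N C \<theta>' w' x'"
    using r.Q_system_P[OF c, of \<theta>' C] rP t.star_hom_e dim N.closed(1)
    by (simp add: \<theta>'_def)
  show "Q_system_of_hom N M \<beta> \<theta>' w' x'" if range: "range_of_proj N M \<iota> e \<beta>"
  proof -
    obtain s where s: "s \<in> M" "is_isometry s" "s * adj s = e"
        and \<beta>: "\<And>n. n \<in> N \<Longrightarrow> \<beta> n = adj s * \<iota> n * s"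
      using range unfolding range_of_proj_def by blast
    \<comment> \<open>A nonzero \<open>q\<close> is the range of an isometry, so the conjugate of
      the range of \<open>e\<close> can be cut out along it.\<close>
    have "q \<noteq> 0" using P by auto
    then obtain t where t: "t \<in> N" "is_isometry t" "t * adj t = q"
      using dual.isometry_onto_Hom[OF c.f] by blast
    interpret rp: reduced_pair N M \<iota> \<iota>' w v e q s t by unfold_locales (use s t in auto)
    note std = rp.reduced_standard[OF Q_rules(7) v_norm minimal_\<iota> c, of \<beta>, OF _ \<beta>]
    have "Q_equivalent N ((\<lambda>m. adj t * \<iota>' m * t) \<circ> \<beta>) (adj t * \<iota>' (adj s) * w)
        (adj t * \<iota>' (adj s * \<iota> (adj t) * v) * t) \<theta>' (adj S * w)
        (adj S * \<iota>' (\<iota> (adj S)) * \<iota>' v * S)"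
      by (rule rp.reduced_Q_equivalent) (use S P \<beta> in \<open>simp_all add: \<theta>'_def \<iota>'_\<iota>\<close>)
    then have "Q_equivalent N ((\<lambda>m. adj t * \<iota>' m * t) \<circ> \<beta>) (adj t * \<iota>' (adj s) * w)
        ((\<lambda>m. adj t * \<iota>' m * t) (adj s * \<iota> (adj t) * v)) \<theta>' w' x'"
      using rP(1,2)[OF N.closed(1)] by (simp only: r.P_defs)
    then show ?thesis
      unfolding Q_system_of_hom_def using std range_star_hom[OF range] by blast
  qed
qed

end

theorem proposition4p9:
  fixes N :: "'h::chilbert_space bop set"
    and M :: "'k::chilbert_space bop set"
    and C :: "('h bop \<Rightarrow> 'h bop) set"
    and \<theta> :: "'h bop \<Rightarrow> 'h bop" and w x p q P :: "'h bop"
    and \<iota> :: "'h bop \<Rightarrow> 'k bop" and \<iota>' :: "'k bop \<Rightarrow> 'h bop" and v :: "'k bop"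
  assumes separable: "\<exists>D :: 'h set. countable D \<and> closure D = UNIV"
    and N: "type_III_factor N"
    and C: "tensor_subcategory N C"
    and Q: "Q_system N C \<theta> w x"
    and ext: "Q_extension N \<theta> w x M \<iota> v \<iota>'"
    and simple: "factor M"
    and data:
      "(right_reducing N \<theta> w x p \<and> q = hprod \<theta> (adj w * p) 1 * x \<and> P = q * p) \<or>
       (left_reducing N \<theta> w x q \<and> p = hprod \<theta> 1 (adj w * q) * x \<and> P = q * p) \<or>
       (two_sided_reducing N \<theta> w x P \<and>
          q = hprod \<theta> (adj w * P) 1 * x \<and> p = hprod \<theta> 1 (adj w * P) * x)"
  shows
    "right_reducing N \<theta> w x p \<and> left_reducing N \<theta> w x q \<and> two_sided_reducing N \<theta> w x P \<and>
     q = hprod \<theta> (adj w * p) 1 * x \<and> p = hprod \<theta> 1 (adj w * q) * x \<and> P = q * p \<and>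
     q = hprod \<theta> (adj w * P) 1 * x \<and> p = hprod \<theta> 1 (adj w * P) * x \<and>
     (\<forall>S\<in>N. P \<noteq> 0 \<and> is_isometry S \<and> S * adj S = P \<longrightarrow>
        (let \<theta>\<^sub>P = (\<lambda>n. adj S * \<theta> n * S);
             w\<^sub>P = adj S * w;
             x\<^sub>P = hprod \<theta> (adj S) (adj S) * x * S
         in
           adj S * adj x * hprod \<theta> P P * x * S
             = complex_of_real (sqrt (hom_dim N N \<theta>\<^sub>P)) *\<^sub>C 1 \<and>
           Q_system N C \<theta>\<^sub>P w\<^sub>P x\<^sub>P \<and>
           (\<exists>!e. e \<in> Hom N M \<iota> \<iota> \<and> is_proj e \<and> \<iota>' e = p) \<and>
           (\<forall>e. e \<in> Hom N M \<iota> \<iota> \<and> is_proj e \<and> \<iota>' e = p \<longrightarrow>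
              (\<exists>\<iota>\<^sub>p. range_of_proj N M \<iota> e \<iota>\<^sub>p) \<and>
              (\<forall>\<iota>\<^sub>p. range_of_proj N M \<iota> e \<iota>\<^sub>p \<longrightarrow>
                 subobject N M \<iota>\<^sub>p \<iota> \<and>
                 Q_system_of_hom N M \<iota>\<^sub>p \<theta>\<^sub>P w\<^sub>P x\<^sub>P \<and>
                 (if e = 1 then unitarily_equivalent N M \<iota> \<iota>\<^sub>p
                  else (\<exists>\<iota>\<^sub>q. range_of_proj N M \<iota> (1 - e) \<iota>\<^sub>q) \<and>
                       (\<forall>\<iota>\<^sub>q. range_of_proj N M \<iota> (1 - e) \<iota>\<^sub>q \<longrightarrow>
                          direct_sum N M \<iota> \<iota>\<^sub>p \<iota>\<^sub>q))))))"
proof -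
  interpret X: factor_extension N M C \<theta> w x \<iota> v \<iota>'
    by unfold_locales (use N C Q ext simple in \<open>auto simp: type_III_factor_def\<close>)
  have "P = q * p \<and> (\<exists>e. conjugate_projections N M \<iota> \<iota>' w v e q \<and> p = \<iota>' e)"
    using data X.projections_of_right_reducing X.projections_of_left_reducing
      X.projections_of_two_sided_reducing by blast
  then obtain e where P: "P = q * p" and cp: "conjugate_projections N M \<iota> \<iota>' w v e q"
    and p: "p = \<iota>' e" by blast
  interpret c: conjugate_projections N M \<iota> \<iota>' w v e q by (rule cp)
  have e_unique: "e' = e" if "e' \<in> Hom N M \<iota> \<iota>" "\<iota>' e' = p" for e'
    using X.\<alpha>'_inj[of e' e] HomD(1)[OF that(1)] that(2) p by simp
  have main: "let \<theta>\<^sub>P = (\<lambda>n. adj S * \<theta> n * S);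
             w\<^sub>P = adj S * w;
             x\<^sub>P = hprod \<theta> (adj S) (adj S) * x * S
         in
           adj S * adj x * hprod \<theta> P P * x * S
             = complex_of_real (sqrt (hom_dim N N \<theta>\<^sub>P)) *\<^sub>C 1 \<and>
           Q_system N C \<theta>\<^sub>P w\<^sub>P x\<^sub>P \<and>
           (\<exists>!e. e \<in> Hom N M \<iota> \<iota> \<and> is_proj e \<and> \<iota>' e = p) \<and>
           (\<forall>e. e \<in> Hom N M \<iota> \<iota> \<and> is_proj e \<and> \<iota>' e = p \<longrightarrow>
              (\<exists>\<iota>\<^sub>p. range_of_proj N M \<iota> e \<iota>\<^sub>p) \<and>
              (\<forall>\<iota>\<^sub>p. range_of_proj N M \<iota> e \<iota>\<^sub>p \<longrightarrow>
                 subobject N M \<iota>\<^sub>p \<iota> \<and>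
                 Q_system_of_hom N M \<iota>\<^sub>p \<theta>\<^sub>P w\<^sub>P x\<^sub>P \<and>
                 (if e = 1 then unitarily_equivalent N M \<iota> \<iota>\<^sub>p
                  else (\<exists>\<iota>\<^sub>q. range_of_proj N M \<iota> (1 - e) \<iota>\<^sub>q) \<and>
                       (\<forall>\<iota>\<^sub>q. range_of_proj N M \<iota> (1 - e) \<iota>\<^sub>q \<longrightarrow>
                          direct_sum N M \<iota> \<iota>\<^sub>p \<iota>\<^sub>q))))"
    if S: "S \<in> N" "is_isometry S" "S * adj S = P" and P0: "P \<noteq> 0" for S
  proof -
    note red = X.reduced_Q_system[OF cp P[unfolded p] P0 S]
    interpret compl: conjugate_projections N M \<iota> \<iota>' w v "1 - e" "1 - q" by (rule c.complement)
    have "e \<noteq> 0" using P0 P p by auto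
    then have r: "\<exists>\<iota>\<^sub>p. range_of_proj N M \<iota> e \<iota>\<^sub>p" by (rule X.range_exists[OF c.e])
    have r': "\<exists>\<iota>\<^sub>q. range_of_proj N M \<iota> (1 - e) \<iota>\<^sub>q" if "e \<noteq> 1"
      by (rule X.range_exists[OF compl.e]) (use that in simp)
    show ?thesis
      unfolding Let_def
    proof (intro conjI allI impI)
      show "\<exists>!e. e \<in> Hom N M \<iota> \<iota> \<and> is_proj e \<and> \<iota>' e = p"
        using c.e p e_unique by blast
      fix e' assume "e' \<in> Hom N M \<iota> \<iota> \<and> is_proj e' \<and> \<iota>' e' = p"
      then have e': "e' = e" using e_unique by blast
      show "\<exists>\<iota>\<^sub>p. range_of_proj N M \<iota> e' \<iota>\<^sub>p" using r e' by simp
      fix \<iota>\<^sub>p assume "range_of_proj N M \<iota> e' \<iota>\<^sub>p"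
      then have rp: "range_of_proj N M \<iota> e \<iota>\<^sub>p" using e' by simp
      then show "subobject N M \<iota>\<^sub>p \<iota>" unfolding subobject_def by blast
      show "Q_system_of_hom N M \<iota>\<^sub>p (\<lambda>n. adj S * \<theta> n * S) (adj S * w)
          (hprod \<theta> (adj S) (adj S) * x * S)"
        by (rule red(3)[OF rp])
      show "if e' = 1 then unitarily_equivalent N M \<iota> \<iota>\<^sub>p
          else (\<exists>\<iota>\<^sub>q. range_of_proj N M \<iota> (1 - e') \<iota>\<^sub>q) \<and>
            (\<forall>\<iota>\<^sub>q. range_of_proj N M \<iota> (1 - e') \<iota>\<^sub>q \<longrightarrow> direct_sum N M \<iota> \<iota>\<^sub>p \<iota>\<^sub>q)"
        using X.range_one[of \<iota>\<^sub>p] rp r' X.direct_sum_ranges[OF rp] unfolding e' by auto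
    qed (use red in auto)
  qed
  show ?thesis
    using X.reducing_of_projections[OF cp p P] P main by blast
qed

end
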